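(* Let $X$ be a Banach sequence space over $\mathbb{Z}$ in which $(e_n)_{n\in\mathbb{Z}}$ is a basis. Let $w=(w_n)_{n\in\mathbb{Z}}$ be a sequence of non-zero scalars such that the weighted backward shift $B_w$ is an operator on $X$, and define $v=(v_n)_{n\in\mathbb{Z}}$ by $$v_n=\frac{1}{w_1\cdots w_n}\ (n>0),\qquad v_0=1,\qquad v_n=w_{n+1}\cdots w_0\ (n<0).$$ Let $\mathcal{A}$ be a Furstenberg family. Consider the following condition. (C) For some sequence $(\varepsilon_p)_{p\geq1}$ of positive numbers tending to $0$ there is a sequence $(A_p)_{p\geq1}$ of pairwise disjoint sets in $\mathcal{A}$ such that (i) for any $p\geq1$, the series $\sum_{n\in A_p}v_{n+p}\,e_{n+p}$ converges in $X$; (ii) for any $p,q\geq1$, any $m\in A_q$, and any $j=-p,\ldots,p$, $$\Big\|\sum_{n\in A_p,\ n\neq m}v_{n-m+j}\,e_{n-m+j}\Big\|<\min(\varepsilon_p,\varepsilon_q).$$ Then: 1. Condition (C) is equivalent to the condition obtained by replacing "for some sequence $(\varepsilon_p)$" with "for all sequences $(\varepsilon_p)$" (of positive numbers tending to $0$). 2. If (C) holds, then $B_w$ is $\mathcal{A}$-hypercyclic on $X$. 3. If $(e_n)_{n\in\mathbb{Z}}$ is an unconditional basis in $X$, then the converse of 2 also holds. 4. If $B_w$ is invertible, then it suffices to require the inequality in (ii) for $j=0$ only; and in (i) one may demand instead that $\sum_{n\in A_p}v_ne_n$ converges in $X$ for any $p\geq1$.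
   Context: Scalars are real or complex ($\mathbb{K}=\mathbb{R}$ or $\mathbb{C}$). An operator on a Banach space is a continuous linear self-map. A Banach sequence space over $\mathbb{Z}$ is a Banach space $X$ that is a subspace of $\mathbb{K}^{\mathbb{Z}}$ such that each coordinate functional $(x_n)_{n\in\mathbb{Z}}\mapsto x_k$, $k\in\mathbb{Z}$, is continuous on $X$. The canonical unit sequences are $e_n=(\delta_{n,k})_{k\in\mathbb{Z}}$. That $(e_n)_{n\in\mathbb{Z}}$ is a basis of $X$ means that all $e_n$ lie in $X$ and every $x=(x_n)\in X$ satisfies $x=\lim_{m,n\to\infty}\sum_{-m\leq k\leq n}x_ke_k$ in $X$; it is unconditional if these series converge unconditionally. Series $\sum_{n\in A}$ over subsets $A\subset\mathbb{N}_0$ are summed in increasing order of $n$. The bilateral weighted backward shift is $B_w(x_n)_{n\in\mathbb{Z}}=(w_{n+1}x_{n+1})_{n\in\mathbb{Z}}$. A Furstenberg family is a non-empty family $\mathcal{A}$ of subsets of $\mathbb{N}_0$ such that $A\in\mathcal{A}$ and $A\subset B\subset\mathbb{N}_0$ imply $B\in\mathcal{A}$. An operator $T$ on a Banach space $X$ is $\mathcal{A}$-hypercyclic if there is a vector $x\in X$ such that, for any non-empty open subset $U$ of $X$, $\{n\geq0:T^nx\in U\}\in\mathcal{A}$. *)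

theory Defs
  imports "HOL-Analysis.Analysis" "HOL-Library.Function_Algebras"
begin

text \<open>
  The scalar sort \<open>{real_normed_field, euclidean_space}\<close> consists, up to isometric isomorphism,
  of the real and the complex numbers: a finite-dimensional field extension of the reals has
  dimension 1 or 2, and a multiplicative norm on it is the usual absolute value.
  Both \<^typ>\<open>real\<close> and \<^typ>\<open>complex\<close> are instances.
\<close>

definition seq_scale :: "'k::times \<Rightarrow> (int \<Rightarrow> 'k) \<Rightarrow> (int \<Rightarrow> 'k)"
  where "seq_scale c x = (\<lambda>n. c * x n)"

definition unit_seq :: "int \<Rightarrow> (int \<Rightarrow> 'k::zero_neq_one)"
  where "unit_seq n = (\<lambda>k. if k = n then 1 else 0)"

text \<open>
  A sequence space is given by its carrier \<open>X\<close> and its norm \<open>N\<close>; values of \<open>N\<close> outside \<open>X\<close> are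
  irrelevant. \<^locale>\<open>Metric_space\<close> demands symmetry and nonnegativity of the distance on the whole
  type, hence the cut-off.
\<close>

definition norm_dist :: "(int \<Rightarrow> 'k::real_normed_field) set \<Rightarrow> ((int \<Rightarrow> 'k) \<Rightarrow> real)
    \<Rightarrow> (int \<Rightarrow> 'k) \<Rightarrow> (int \<Rightarrow> 'k) \<Rightarrow> real"
  where "norm_dist X N x y = (if x \<in> X \<and> y \<in> X then N (x - y) else 0)"

abbreviation norm_topology :: "(int \<Rightarrow> 'k::real_normed_field) set \<Rightarrow> ((int \<Rightarrow> 'k) \<Rightarrow> real)
    \<Rightarrow> (int \<Rightarrow> 'k) topology"
  where "norm_topology X N \<equiv> Metric_space.mtopology X (norm_dist X N)"

locale banach_sequence_space =
  fixes X :: "(int \<Rightarrow> 'k::{real_normed_field, euclidean_space}) set"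
    and N :: "(int \<Rightarrow> 'k) \<Rightarrow> real"
  assumes zero_mem: "0 \<in> X"
    and add_mem: "\<lbrakk>x \<in> X; y \<in> X\<rbrakk> \<Longrightarrow> x + y \<in> X"
    and scale_mem: "x \<in> X \<Longrightarrow> seq_scale c x \<in> X"
    and norm_ge_zero: "x \<in> X \<Longrightarrow> 0 \<le> N x"
    and norm_eq_zero: "x \<in> X \<Longrightarrow> N x = 0 \<longleftrightarrow> x = 0"
    and norm_triangle: "\<lbrakk>x \<in> X; y \<in> X\<rbrakk> \<Longrightarrow> N (x + y) \<le> N x + N y"
    and norm_scale: "x \<in> X \<Longrightarrow> N (seq_scale c x) = norm c * N x"
    and complete: "Metric_space.mcomplete X (norm_dist X N)"
    and continuous_coordinate: "continuous_map (norm_topology X N) euclidean (\<lambda>x. x k)"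

definition unit_basis :: "(int \<Rightarrow> 'k::real_normed_field) set \<Rightarrow> ((int \<Rightarrow> 'k) \<Rightarrow> real) \<Rightarrow> bool"
  where "unit_basis X N \<longleftrightarrow>
    (\<forall>n. unit_seq n \<in> X) \<and>
    (\<forall>x\<in>X. limitin (norm_topology X N)
       (\<lambda>(m, n). \<Sum>k = - int m..int n. seq_scale (x k) (unit_seq k)) x
       (sequentially \<times>\<^sub>F sequentially))"

text \<open>
  Unconditional convergence is convergence of all rearrangements; here a rearrangement of a series
  over the integers is an enumeration of the integers by the natural numbers.
\<close>

definition unconditional_unit_basis ::
    "(int \<Rightarrow> 'k::real_normed_field) set \<Rightarrow> ((int \<Rightarrow> 'k) \<Rightarrow> real) \<Rightarrow> bool"
  where "unconditional_unit_basis X N \<longleftrightarrow>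
    unit_basis X N \<and>
    (\<forall>x\<in>X. \<forall>\<sigma> :: nat \<Rightarrow> int. bij \<sigma> \<longrightarrow>
       (\<exists>s. limitin (norm_topology X N)
          (\<lambda>n. \<Sum>i<n. seq_scale (x (\<sigma> i)) (unit_seq (\<sigma> i))) s sequentially))"

text \<open>Summation over a set of natural numbers in increasing order, with convergence in \<open>X\<close>:\<close>

definition has_series_sum :: "(int \<Rightarrow> 'k::real_normed_field) set \<Rightarrow> ((int \<Rightarrow> 'k) \<Rightarrow> real)
    \<Rightarrow> (nat \<Rightarrow> int \<Rightarrow> 'k) \<Rightarrow> nat set \<Rightarrow> (int \<Rightarrow> 'k) \<Rightarrow> bool"
  where "has_series_sum X N f A s \<longleftrightarrow>
    limitin (norm_topology X N) (\<lambda>M. \<Sum>n \<in> A \<inter> {..<M}. f n) s sequentially"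

definition operator_on :: "(int \<Rightarrow> 'k::real_normed_field) set \<Rightarrow> ((int \<Rightarrow> 'k) \<Rightarrow> real)
    \<Rightarrow> ((int \<Rightarrow> 'k) \<Rightarrow> (int \<Rightarrow> 'k)) \<Rightarrow> bool"
  where "operator_on X N T \<longleftrightarrow>
    T ` X \<subseteq> X \<and>
    (\<forall>x\<in>X. \<forall>y\<in>X. T (x + y) = T x + T y) \<and>
    (\<forall>c. \<forall>x\<in>X. T (seq_scale c x) = seq_scale c (T x)) \<and>
    continuous_map (norm_topology X N) (norm_topology X N) T"

definition invertible_on :: "(int \<Rightarrow> 'k::real_normed_field) set \<Rightarrow> ((int \<Rightarrow> 'k) \<Rightarrow> real)
    \<Rightarrow> ((int \<Rightarrow> 'k) \<Rightarrow> (int \<Rightarrow> 'k)) \<Rightarrow> bool"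
  where "invertible_on X N T \<longleftrightarrow>
    (\<exists>S. operator_on X N S \<and> (\<forall>x\<in>X. S (T x) = x \<and> T (S x) = x))"

definition backward_shift :: "(int \<Rightarrow> 'k::times) \<Rightarrow> (int \<Rightarrow> 'k) \<Rightarrow> (int \<Rightarrow> 'k)"
  where "backward_shift w x = (\<lambda>n. w (n + 1) * x (n + 1))"

definition furstenberg_family :: "nat set set \<Rightarrow> bool"
  where "furstenberg_family \<A> \<longleftrightarrow> \<A> \<noteq> {} \<and> (\<forall>A\<in>\<A>. \<forall>B. A \<subseteq> B \<longrightarrow> B \<in> \<A>)"

definition family_hypercyclic :: "nat set set \<Rightarrow> (int \<Rightarrow> 'k::real_normed_field) set
    \<Rightarrow> ((int \<Rightarrow> 'k) \<Rightarrow> real) \<Rightarrow> ((int \<Rightarrow> 'k) \<Rightarrow> (int \<Rightarrow> 'k)) \<Rightarrow> bool"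
  where "family_hypercyclic \<A> X N T \<longleftrightarrow>
    (\<exists>x\<in>X. \<forall>U. openin (norm_topology X N) U \<and> U \<noteq> {} \<longrightarrow> {n. (T ^^ n) x \<in> U} \<in> \<A>)"

text \<open>For \<open>n = 0\<close> the product below is empty, so \<open>shift_coeff w 0 = 1\<close>.\<close>

definition shift_coeff :: "(int \<Rightarrow> 'k::field) \<Rightarrow> int \<Rightarrow> 'k"
  where "shift_coeff w n = (if n > 0 then 1 / (\<Prod>i = 1..n. w i) else (\<Prod>i = n + 1..0. w i))"

abbreviation shift_term :: "(int \<Rightarrow> 'k::field) \<Rightarrow> int \<Rightarrow> (int \<Rightarrow> 'k)"
  where "shift_term w n \<equiv> seq_scale (shift_coeff w n) (unit_seq n)"

text \<open>
  Sequences indexed by \<open>p \<ge> 1\<close> are functions on \<^typ>\<open>nat\<close> whose value at \<open>0\<close> is ignored.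
\<close>

definition positive_null_sequence :: "(nat \<Rightarrow> real) \<Rightarrow> bool"
  where "positive_null_sequence \<epsilon> \<longleftrightarrow> (\<forall>p\<ge>1. 0 < \<epsilon> p) \<and> \<epsilon> \<longlonglongrightarrow> 0"

definition disjoint_members :: "nat set set \<Rightarrow> (nat \<Rightarrow> nat set) \<Rightarrow> bool"
  where "disjoint_members \<A> A \<longleftrightarrow> (\<forall>p\<ge>1. A p \<in> \<A>) \<and> disjoint_family_on A {1..}"

definition shifted_series_converge :: "(int \<Rightarrow> 'k::real_normed_field) set \<Rightarrow> ((int \<Rightarrow> 'k) \<Rightarrow> real)
    \<Rightarrow> (int \<Rightarrow> 'k) \<Rightarrow> (nat \<Rightarrow> nat set) \<Rightarrow> bool"
  where "shifted_series_converge X N w A \<longleftrightarrow>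
    (\<forall>p\<ge>1. \<exists>s. has_series_sum X N (\<lambda>n. shift_term w (int n + int p)) (A p) s)"

definition unshifted_series_converge :: "(int \<Rightarrow> 'k::real_normed_field) set \<Rightarrow> ((int \<Rightarrow> 'k) \<Rightarrow> real)
    \<Rightarrow> (int \<Rightarrow> 'k) \<Rightarrow> (nat \<Rightarrow> nat set) \<Rightarrow> bool"
  where "unshifted_series_converge X N w A \<longleftrightarrow>
    (\<forall>p\<ge>1. \<exists>s. has_series_sum X N (\<lambda>n. shift_term w (int n)) (A p) s)"

text \<open>
  The norm inequality is understood to include convergence of the series; \<open>J p\<close> is the set of
  admissible shifts \<open>j\<close>.
\<close>

definition small_differences :: "(int \<Rightarrow> 'k::real_normed_field) set \<Rightarrow> ((int \<Rightarrow> 'k) \<Rightarrow> real)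
    \<Rightarrow> (int \<Rightarrow> 'k) \<Rightarrow> (nat \<Rightarrow> int set) \<Rightarrow> (nat \<Rightarrow> real) \<Rightarrow> (nat \<Rightarrow> nat set) \<Rightarrow> bool"
  where "small_differences X N w J \<epsilon> A \<longleftrightarrow>
    (\<forall>p\<ge>1. \<forall>q\<ge>1. \<forall>m\<in>A q. \<forall>j\<in>J p.
       \<exists>s. has_series_sum X N (\<lambda>n. shift_term w (int n - int m + j)) (A p - {m}) s \<and>
           N s < min (\<epsilon> p) (\<epsilon> q))"

definition condition_C :: "nat set set \<Rightarrow> (int \<Rightarrow> 'k::real_normed_field) set
    \<Rightarrow> ((int \<Rightarrow> 'k) \<Rightarrow> real) \<Rightarrow> (int \<Rightarrow> 'k) \<Rightarrow> (nat \<Rightarrow> real) \<Rightarrow> bool"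
  where "condition_C \<A> X N w \<epsilon> \<longleftrightarrow>
    (\<exists>A. disjoint_members \<A> A \<and> shifted_series_converge X N w A \<and>
         small_differences X N w (\<lambda>p. {- int p..int p}) \<epsilon> A)"

end

theory Submission
  imports Defs
begin

text \<open>
  Let $u_n = v_n e_n$ and $T = B_w$. The weights $v_n$ are chosen such that $T u_n = u_{n-1}$, so in
  the coordinates given by $(u_n)$ the operator is the plain backward shift, and
  $\sum_{n \in A} u_{n+j}$ is a vector that $T^m$, for $m \in A$, takes to $u_j$ plus the sum
  $\sum_{n \in A, n \neq m} u_{n-m+j}$ that condition (C) controls.

  The choice of $(\varepsilon_p)$ is immaterial because one may pass to a subsequence of $(A_p)$:
  (i) for $A_{p_k}$ gives convergence of the series shifted by $p_k \geq k$, and a power of $T$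
  lowers the shift to $k$ (\<open>condition_C_change_sequence\<close>).

  Given (C), the hypercyclic vector is $x = \sum_k \sum_{|j| \leq k} a_{k,j} \sum_{n \in A_{p_k}} u_{n+j}$,
  where the targets $\sum_{|j| \leq k} a_{k,j} u_j$ run through a dense sequence. Condition (ii) makes
  $T^m x$ close to the $l$-th target for $m \in A_{p_l}$. It also yields the convergence of the outer
  series, on which (i) says nothing: for a fixed $m_0 \in A_1$ and large $p$, the shift by
  $j = m_0 + i$ is admissible in (ii), and it bounds $\sum_{n \in A_p} u_{n+i}$ itself by $\varepsilon_p$
  (\<open>family_hypercyclic_if_condition_C\<close>).

  For the converse, let $A_p$ be the set of return times of an $\mathcal{A}$-hypercyclic vector
  $x = \sum_k \xi_k u_k$ to a small ball around $p \sum_{|j| \leq p} u_j$. If $n \in A_p$, then $\xi_{n+j}$ is close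
  to $p$ for $|j| \leq p$ and close to $0$ for $p < |j| \leq 3p$; therefore distinct return times
  $n \in A_p$, $m \in A_q$ differ by more than $p + q$. The sums in (ii) then live on indices
  where $T^m x$ is small but has coefficients of size about $p$, so they are dominated
  coordinatewise by a small vector. In an unconditional basis such domination gives convergence and
  a norm bound with a uniform constant (\<open>dominated_series\<close>), which comes from the Baire category
  theorem (\<open>proj_uniformly_bounded\<close>).

  If $T$ is invertible, then $T^{-1} u_n = u_{n+1}$. All shifts $j$ arise from $j = 0$ by bounded
  operators, whose norms are absorbed by passing to a subsequence.
\<close>

section \<open>Normed sequence spaces and their operators\<close>

lemma seq_scale_apply: "seq_scale c x k = c * x k"
  by (simp add: seq_scale_def)

lemma seq_scale_seq_scale: "seq_scale (c::'k::real_normed_field) (seq_scale d x) = seq_scale (c * d) x"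
  by (simp add: fun_eq_iff seq_scale_apply algebra_simps)

lemma seq_scale_zero_left [simp]: "seq_scale (0::'k::real_normed_field) x = 0"
  by (simp add: fun_eq_iff seq_scale_apply)

lemma sum_seq_apply: "(\<Sum>i\<in>I. f i) k = (\<Sum>i\<in>I. f i k)" for f :: "'a \<Rightarrow> 'b \<Rightarrow> 'c::ab_group_add"
  by (induction I rule: infinite_finite_induct) auto

lemma seq_scale_sum: "seq_scale (c::'k::real_normed_field) (\<Sum>i\<in>I. f i) = (\<Sum>i\<in>I. seq_scale c (f i))"
  by (simp add: fun_eq_iff seq_scale_apply sum_seq_apply sum_distrib_left)

context banach_sequence_space
begin

lemma uminus_mem: "x \<in> X \<Longrightarrow> - x \<in> X"
  using scale_mem[of x "-1"] by (simp add: seq_scale_def fun_Compl_def)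

lemma norm_uminus: "x \<in> X \<Longrightarrow> N (- x) = N x"
  using norm_scale[of x "-1"] by (simp add: seq_scale_def fun_Compl_def)

lemma diff_mem: "x \<in> X \<Longrightarrow> y \<in> X \<Longrightarrow> x - y \<in> X"
  using add_mem[of x "- y"] uminus_mem by simp

lemma norm_zero: "N 0 = 0"
  using norm_eq_zero zero_mem by blast

lemma norm_diff_le: "x \<in> X \<Longrightarrow> y \<in> X \<Longrightarrow> N (x - y) \<le> N x + N y"
  using norm_triangle[of x "- y"] uminus_mem norm_uminus by simp

lemma norm_diff_commute: "x \<in> X \<Longrightarrow> y \<in> X \<Longrightarrow> N (x - y) = N (y - x)"
  using norm_uminus[of "x - y"] diff_mem by simp

lemma norm_triangle_sub: "x \<in> X \<Longrightarrow> y \<in> X \<Longrightarrow> N x \<le> N y + N (x - y)"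
  using norm_triangle[of y "x - y"] diff_mem by simp

lemma sum_mem: "(\<And>i. i \<in> I \<Longrightarrow> f i \<in> X) \<Longrightarrow> (\<Sum>i\<in>I. f i) \<in> X"
  by (induction I rule: infinite_finite_induct) (auto simp: zero_mem add_mem)

lemma norm_sum_le: "(\<And>i. i \<in> I \<Longrightarrow> f i \<in> X) \<Longrightarrow> N (\<Sum>i\<in>I. f i) \<le> (\<Sum>i\<in>I. N (f i))"
proof (induction I rule: infinite_finite_induct)
  case (insert i I)
  then have "N (f i + sum f I) \<le> N (f i) + N (sum f I)"
    by (intro norm_triangle sum_mem) auto
  moreover have "N (sum f I) \<le> (\<Sum>i\<in>I. N (f i))" using insert by blast
  ultimately show ?case by (simp only: sum.insert[OF insert(1,2)])
qed (auto simp: norm_zero)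

sublocale metric: Metric_space X "norm_dist X N"
proof
  fix x y z
  show "0 \<le> norm_dist X N x y"
    by (simp add: norm_dist_def norm_ge_zero diff_mem)
  show "norm_dist X N x y = norm_dist X N y x"
    by (simp add: norm_dist_def norm_diff_commute)
  assume "x \<in> X" "y \<in> X"
  then show "norm_dist X N x y = 0 \<longleftrightarrow> x = y"
    by (simp add: norm_dist_def norm_eq_zero diff_mem)
  assume "z \<in> X"
  have "x - z = (x - y) + (y - z)" by simp
  then have "N (x - z) \<le> N (x - y) + N (y - z)"
    using \<open>x \<in> X\<close> \<open>y \<in> X\<close> \<open>z \<in> X\<close> by (metis norm_triangle diff_mem)
  then show "norm_dist X N x z \<le> norm_dist X N x y + norm_dist X N y z"
    using \<open>x \<in> X\<close> \<open>y \<in> X\<close> \<open>z \<in> X\<close> by (simp add: norm_dist_def)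
qed

abbreviation "tends_to f s F \<equiv> limitin (norm_topology X N) f s F"

lemma tends_to_iff:
  "tends_to f s F \<longleftrightarrow> s \<in> X \<and> (\<forall>e>0. eventually (\<lambda>n. f n \<in> X \<and> N (f n - s) < e) F)"
proof -
  have "s \<in> X \<Longrightarrow> (f n \<in> X \<and> norm_dist X N (f n) s < e) = (f n \<in> X \<and> N (f n - s) < e)" for n e
    by (auto simp: norm_dist_def)
  then show ?thesis by (auto simp: metric.limitin_metric)
qed

lemma tends_to_mem: "tends_to f s F \<Longrightarrow> s \<in> X"
  by (simp add: tends_to_iff)

lemma tends_to_unique: "tends_to f s sequentially \<Longrightarrow> tends_to f t sequentially \<Longrightarrow> s = t"
  by (rule metric.limitin_metric_unique) auto

lemma openin_norm_topology:
  "openin (norm_topology X N) U \<longleftrightarrow> U \<subseteq> X \<and> (\<forall>x\<in>U. \<exists>r>0. \<forall>y\<in>X. N (y - x) < r \<longrightarrow> y \<in> U)"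
proof -
  have "metric.mball x r \<subseteq> U \<longleftrightarrow> (\<forall>y\<in>X. N (y - x) < r \<longrightarrow> y \<in> U)" if "x \<in> X" for x r
    using that by (auto simp: metric.mball_def norm_dist_def norm_diff_commute)
  then show ?thesis
    by (auto simp: metric.openin_mtopology subset_iff) 
qed

lemma openin_ball: "y \<in> X \<Longrightarrow> openin (norm_topology X N) {z \<in> X. N (z - y) < r}"
proof -
  assume "y \<in> X"
  then have "{z \<in> X. N (z - y) < r} = metric.mball y r"
    by (auto simp: metric.mball_def norm_dist_def norm_diff_commute)
  then show ?thesis by simp
qed

text \<open>
  Lower semicontinuity of the norm: bounds proved for partial sums pass to the sums of series.
\<close>

lemma tends_to_norm_le:
  assumes "tends_to f s F" "F \<noteq> bot" "eventually (\<lambda>n. N (f n) \<le> B) F"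
  shows "N s \<le> B"
proof (rule field_le_epsilon)
  fix e :: real assume "e > 0"
  with assms have "eventually (\<lambda>n. f n \<in> X \<and> N (f n - s) < e \<and> N (f n) \<le> B) F"
    by (auto simp: tends_to_iff eventually_conj_iff)
  then obtain n where n: "f n \<in> X" "N (f n - s) < e" "N (f n) \<le> B"
    using eventually_happens'[OF assms(2)] by blast
  with assms norm_triangle_sub[of s "f n"] norm_diff_commute[of s "f n"] show "N s \<le> B + e"
    by (simp add: tends_to_iff)
qed

lemma tends_to_const: "s \<in> X \<Longrightarrow> tends_to (\<lambda>_. s) s F"
  by (simp add: tends_to_iff norm_zero)

lemma tends_to_add:
  assumes "tends_to f s F" "tends_to g t F"
  shows "tends_to (\<lambda>n. f n + g n) (s + t) F"
  unfolding tends_to_iff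
proof (intro conjI allI impI)
  show "s + t \<in> X" using assms by (simp add: tends_to_iff add_mem)
  fix e :: real assume "e > 0"
  then have "eventually (\<lambda>n. f n \<in> X \<and> N (f n - s) < e/2) F" "eventually (\<lambda>n. g n \<in> X \<and> N (g n - t) < e/2) F"
    using assms half_gt_zero unfolding tends_to_iff by blast+
  then show "eventually (\<lambda>n. f n + g n \<in> X \<and> N (f n + g n - (s + t)) < e) F"
  proof eventually_elim
    case (elim n)
    have "f n + g n - (s + t) = (f n - s) + (g n - t)" by simp
    then have "N (f n + g n - (s + t)) \<le> N (f n - s) + N (g n - t)"
      using elim assms by (metis norm_triangle diff_mem tends_to_mem)
    with elim show ?case by (auto simp: add_mem)
  qed
qed

lemma bounded_map_tends_to:
  assumes "tends_to f s F" and "\<And>x. x \<in> X \<Longrightarrow> T x \<in> X"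
    and "\<And>x y. x \<in> X \<Longrightarrow> y \<in> X \<Longrightarrow> N (T x - T y) \<le> K * N (x - y)"
  shows "tends_to (\<lambda>n. T (f n)) (T s) F"
  unfolding tends_to_iff
proof (intro conjI allI impI)
  show "T s \<in> X" using assms by (simp add: tends_to_iff)
  fix e :: real assume "e > 0"
  then have "e / (\<bar>K\<bar> + 1) > 0" by (simp add: divide_pos_pos)
  then have "eventually (\<lambda>n. f n \<in> X \<and> N (f n - s) < e / (\<bar>K\<bar> + 1)) F"
    using assms(1) unfolding tends_to_iff by blast
  then show "eventually (\<lambda>n. T (f n) \<in> X \<and> N (T (f n) - T s) < e) F"
  proof eventually_elim
    case (elim n)
    then have fs: "f n - s \<in> X" and s: "s \<in> X" using assms(1) by (auto simp: tends_to_iff diff_mem)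
    have "N (T (f n) - T s) \<le> K * N (f n - s)" using elim s assms(3) by blast
    also have "\<dots> \<le> (\<bar>K\<bar> + 1) * N (f n - s)"
      using norm_ge_zero[OF fs] by (intro mult_right_mono) auto
    also have "\<dots> < e"
      using elim by (simp add: field_simps add_pos_nonneg)
    finally show ?case using elim assms(2) by blast
  qed
qed

lemma Cauchy_tends_to:
  assumes "\<And>n. f n \<in> X" and "\<And>e. e > 0 \<Longrightarrow> \<exists>M. \<forall>n\<ge>M. \<forall>m\<ge>n. N (f m - f n) < e"
  shows "\<exists>s. tends_to f s sequentially"
proof -
  have "metric.MCauchy f"
    unfolding metric.MCauchy_def
  proof (intro conjI allI impI)
    show "range f \<subseteq> X" using assms by auto
    fix e :: real assume "e > 0"
    then obtain M where M: "\<forall>n\<ge>M. \<forall>m\<ge>n. N (f m - f n) < e" using assms(2) by blast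
    have "norm_dist X N (f n) (f m) < e" if "n \<ge> M" "m \<ge> M" for n m
    proof -
      have "N (f n - f m) < e"
        using M that norm_diff_commute[OF assms(1) assms(1)] by (metis le_cases)
      then show ?thesis using assms(1) by (simp add: norm_dist_def)
    qed
    then show "\<exists>M. \<forall>n n'. M \<le> n \<longrightarrow> M \<le> n' \<longrightarrow> norm_dist X N (f n) (f n') < e" by blast
  qed
  then show ?thesis using complete unfolding metric.mcomplete_def by blast
qed

lemma tends_to_imp_Cauchy:
  assumes "tends_to f s sequentially" "e > 0"
  shows "\<exists>M. \<forall>n\<ge>M. \<forall>m\<ge>M. N (f m - f n) < e"
proof -
  have "e/2 > 0" using assms by simp
  then obtain M where M: "\<And>n. n \<ge> M \<Longrightarrow> f n \<in> X \<and> N (f n - s) < e/2"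
    using assms(1) unfolding tends_to_iff eventually_sequentially by meson
  have s: "s \<in> X" using assms by (simp add: tends_to_iff)
  have "N (f m - f n) < e" if "n \<ge> M" "m \<ge> M" for n m
  proof -
    have "N (f m - f n) = N ((f m - s) - (f n - s))" by simp
    also have "\<dots> \<le> N (f m - s) + N (f n - s)" using M that s by (intro norm_diff_le diff_mem) auto
    finally show ?thesis using M[OF that(1)] M[OF that(2)] by simp
  qed
  then show ?thesis by blast
qed

lemma absolutely_convergent_series:
  assumes f: "\<And>k. f k \<in> X" and le: "\<And>k. N (f k) \<le> b k" and b: "summable b"
  shows "\<exists>s. tends_to (\<lambda>n. \<Sum>k<n. f k) s sequentially \<and> N s \<le> suminf b"
proof -
  have b0: "b k \<ge> 0" for k using norm_ge_zero[OF f[of k]] le[of k] by linarith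
  have "\<exists>s. tends_to (\<lambda>n. \<Sum>k<n. f k) s sequentially"
  proof (rule Cauchy_tends_to)
    show "(\<Sum>k<n. f k) \<in> X" for n using f by (rule sum_mem)
    fix e :: real assume "e > 0"
    then obtain M where M: "\<And>m n. m \<ge> M \<Longrightarrow> norm (sum b {m..<n}) < e"
      using b unfolding summable_Cauchy by blast
    have "N ((\<Sum>k<m. f k) - (\<Sum>k<n. f k)) < e" if "n \<ge> M" "m \<ge> n" for m n
    proof -
      have "(\<Sum>k<m. f k) - (\<Sum>k<n. f k) = (\<Sum>k\<in>{n..<m}. f k)"
        using that by (subst sum_diff[symmetric]) (auto intro!: sum.cong)
      then have "N ((\<Sum>k<m. f k) - (\<Sum>k<n. f k)) = N (\<Sum>k\<in>{n..<m}. f k)" by (rule arg_cong)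
      also have "\<dots> \<le> (\<Sum>k\<in>{n..<m}. b k)"
        using f le by (intro order_trans[OF norm_sum_le] sum_mono) auto
      also have "\<dots> < e" using M[of n m] that by simp
      finally show ?thesis .
    qed
    then show "\<exists>M. \<forall>n\<ge>M. \<forall>m\<ge>n. N ((\<Sum>k<m. f k) - (\<Sum>k<n. f k)) < e" by blast
  qed
  then obtain s where s: "tends_to (\<lambda>n. \<Sum>k<n. f k) s sequentially" by blast
  have "N (\<Sum>k<n. f k) \<le> suminf b" for n
  proof -
    have "N (\<Sum>k<n. f k) \<le> (\<Sum>k<n. b k)"
      using f le by (intro order_trans[OF norm_sum_le] sum_mono) auto
    also have "\<dots> \<le> suminf b" using b b0 by (intro sum_le_suminf) auto
    finally show ?thesis .
  qed
  then show ?thesis using s tends_to_norm_le[OF s] by auto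
qed

text \<open>
  Continuity at zero of a homogeneous function gives a global linear bound by rescaling. Coordinate
  functionals, operators and, after the Baire argument, the coordinate projections are all
  handled by this one estimate.
\<close>

lemma homogeneous_bound:
  assumes r: "r > 0" "\<And>y. y \<in> X \<Longrightarrow> N y < r \<Longrightarrow> q y < 1"
    and q: "\<And>c x. c > 0 \<Longrightarrow> x \<in> X \<Longrightarrow> q (seq_scale (of_real c) x) = c * q x"
    and x: "x \<in> X"
  shows "q x \<le> 2 / r * N x"
proof (cases "q x > 0")
  case True
  have small: "c * q x < 1" if "c > 0" "c * N x < r" for c
    using r(2)[OF scale_mem[OF x, of "of_real c"]] q[OF that(1) x] norm_scale[OF x, of "of_real c"] that
    by simp
  have "N x \<noteq> 0" using small[of "1 / q x"] True r(1) by auto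
  then have pos: "N x > 0" using norm_ge_zero[OF x] by linarith
  have "r / (2 * N x) * q x < 1"
    using pos r(1) by (intro small) simp_all
  then show ?thesis using pos r(1) by (simp add: field_simps)
next
  case False
  have "0 \<le> 2 / r * N x" using r(1) norm_ge_zero[OF x] by simp
  then show ?thesis using False by linarith
qed

lemma coordinate_bound: "\<exists>K. \<forall>x\<in>X. norm (x k) \<le> K * N x"
proof -
  have "openin (norm_topology X N) {x \<in> X. x k \<in> ball 0 1}"
    using openin_continuous_map_preimage[OF continuous_coordinate[of k], of "ball 0 1"] by simp
  then obtain r where r: "r > 0" "\<And>y. y \<in> X \<Longrightarrow> N y < r \<Longrightarrow> norm (y k) < 1"
    using zero_mem unfolding openin_norm_topology by (auto simp: norm_eq_zero) 
  have "norm (x k) \<le> 2 / r * N x" if "x \<in> X" for x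
    using that r by (intro homogeneous_bound[where q = "\<lambda>x. norm (x k)"]) (auto simp: norm_mult seq_scale_apply)
  then show ?thesis by blast
qed

lemma operator_mem: "operator_on X N T \<Longrightarrow> x \<in> X \<Longrightarrow> T x \<in> X"
  unfolding operator_on_def by blast

lemma operator_add: "operator_on X N T \<Longrightarrow> x \<in> X \<Longrightarrow> y \<in> X \<Longrightarrow> T (x + y) = T x + T y"
  unfolding operator_on_def by blast

lemma operator_scale: "operator_on X N T \<Longrightarrow> x \<in> X \<Longrightarrow> T (seq_scale c x) = seq_scale c (T x)"
  unfolding operator_on_def by blast

lemma operator_zero: "operator_on X N T \<Longrightarrow> T 0 = 0"
  using operator_scale[of T 0 0] zero_mem by simp

lemma operator_diff:
  assumes "operator_on X N T" "x \<in> X" "y \<in> X" shows "T (x - y) = T x - T y"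
  using operator_add[OF assms(1) diff_mem[OF assms(2,3)] assms(3)] by simp

lemma operator_sum:
  assumes "operator_on X N T" "\<And>i. i \<in> I \<Longrightarrow> f i \<in> X"
  shows "T (\<Sum>i\<in>I. f i) = (\<Sum>i\<in>I. T (f i))"
  using assms(2)
proof (induction I rule: infinite_finite_induct)
  case (insert i I)
  then have "T (f i + sum f I) = T (f i) + T (sum f I)"
    by (intro operator_add[OF assms(1)] sum_mem) auto
  moreover have "T (sum f I) = (\<Sum>i\<in>I. T (f i))" using insert by blast
  ultimately show ?case by (simp only: sum.insert[OF insert(1,2)])
qed (use operator_zero[OF assms(1)] in auto)

lemma operator_bound:
  assumes T: "operator_on X N T"
  obtains K where "K > 0" "\<And>x. x \<in> X \<Longrightarrow> N (T x) \<le> K * N x"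
proof -
  have "continuous_map (norm_topology X N) (norm_topology X N) T"
    using T unfolding operator_on_def by blast
  from openin_continuous_map_preimage[OF this openin_ball[OF zero_mem, of 1]]
  have "openin (norm_topology X N) {x \<in> X. T x \<in> {z \<in> X. N (z - 0) < 1}}"
    by (simp only: metric.topspace_mtopology)
  moreover have "0 \<in> {x \<in> X. T x \<in> {z \<in> X. N (z - 0) < 1}}"
    using operator_zero[OF T] zero_mem norm_zero by simp
  ultimately obtain r where r: "r > 0" "\<And>y. y \<in> X \<Longrightarrow> N y < r \<Longrightarrow> N (T y) < 1"
    unfolding openin_norm_topology by auto
  have "N (T x) \<le> 2 / r * N x" if "x \<in> X" for x
    using that r
    by (intro homogeneous_bound[where q = "\<lambda>x. N (T x)"])
      (auto simp: operator_scale[OF T] norm_scale operator_mem[OF T])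
  then show ?thesis using r(1) by (intro that[of "2 / r"]) auto
qed

lemma operator_tends_to:
  assumes T: "operator_on X N T" and f: "tends_to f s F"
  shows "tends_to (\<lambda>n. T (f n)) (T s) F"
proof -
  obtain K where K: "\<And>x. x \<in> X \<Longrightarrow> N (T x) \<le> K * N x" using operator_bound[OF T] by blast
  then show ?thesis
    using operator_mem[OF T] operator_diff[OF T] diff_mem
    by (intro bounded_map_tends_to[OF f, of T K]) metis+
qed

lemma operator_comp:
  assumes "operator_on X N S" "operator_on X N T" shows "operator_on X N (S \<circ> T)"
  using assms continuous_map_compose unfolding operator_on_def by (auto simp: image_subset_iff)

lemma operator_id: "operator_on X N id"
  by (auto simp: operator_on_def continuous_map_id[unfolded id_def] id_def)

lemma operator_funpow: "operator_on X N T \<Longrightarrow> operator_on X N (T ^^ n)"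
  by (induction n) (simp_all add: operator_comp operator_id[unfolded id_def] id_def)

end

section \<open>Subsequences of disjoint families\<close>

lemma diagonal_subsequence_exists:
  assumes "\<And>k. eventually (P k) sequentially"
  shows "\<exists>p::nat \<Rightarrow> nat. strict_mono p \<and> (\<forall>k. P k (p k))"
proof -
  have "\<exists>p. \<forall>k. P k (p k) \<and> p k < p (Suc k)"
  proof (rule dependent_nat_choice)
    show "\<exists>n. P 0 n"
      using assms[of 0] by (rule eventually_happens'[OF sequentially_bot])
    show "\<exists>m. P (Suc k) m \<and> n < m" for n k
      using eventually_happens'[OF sequentially_bot eventually_conj[OF assms[of "Suc k"] eventually_gt_at_top[of n]]]
      by blast
  qed
  then show ?thesis by (auto simp: strict_mono_Suc_iff)
qed

lemma null_sequence_subsequence: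
  fixes \<delta> :: "nat \<Rightarrow> real" and h :: "nat \<Rightarrow> nat"
  assumes \<epsilon>: "positive_null_sequence \<epsilon>" and \<delta>: "\<And>k. 0 < \<delta> k"
  shows "\<exists>p. strict_mono p \<and> (\<forall>k. \<epsilon> (p k) \<le> \<delta> k \<and> h k \<le> p k)"
proof -
  have "\<forall>\<^sub>F n in sequentially. \<epsilon> n \<le> \<delta> k \<and> h k \<le> n" for k
  proof -
    have "\<forall>\<^sub>F n in sequentially. \<epsilon> n < \<delta> k"
      using \<epsilon> \<delta>[of k] by (intro order_tendstoD(2)[of \<epsilon> 0]) (auto simp: positive_null_sequence_def)
    with eventually_ge_at_top[of "h k"] show ?thesis
      by eventually_elim auto
  qed
  from diagonal_subsequence_exists[where P = "\<lambda>k n. \<epsilon> n \<le> \<delta> k \<and> h k \<le> n", OF this]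
  show ?thesis .
qed

lemma inverse_positive_null_sequence: "positive_null_sequence (\<lambda>n. C / real (Suc n))" if "C > 0" for C
  unfolding positive_null_sequence_def
  using that tendsto_mult_right_zero[OF LIMSEQ_inverse_real_of_nat, of C]
  by (auto simp: divide_inverse intro: divide_pos_pos)

lemma disjoint_members_subsequence:
  assumes A: "disjoint_members \<A> A" and p: "strict_mono p"
  shows "disjoint_members \<A> (\<lambda>k. A (p k))"
proof -
  have p1: "p k \<ge> 1" if "k \<ge> 1" for k using seq_suble[OF p, of k] that by linarith
  then have "disjoint_family_on (\<lambda>k. A (p k)) {1..}"
    using A p by (auto simp: disjoint_members_def disjoint_family_on_def strict_mono_eq)
  with A p1 show ?thesis by (auto simp: disjoint_members_def)
qed

context banach_sequence_space
begin

abbreviation "series f A s \<equiv> has_series_sum X N f A s"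

lemma series_mem: "series f A s \<Longrightarrow> s \<in> X"
  by (auto simp: has_series_sum_def tends_to_mem)

lemma series_unique: "series f A s \<Longrightarrow> series f A t \<Longrightarrow> s = t"
  unfolding has_series_sum_def by (rule tends_to_unique)

lemma series_operator:
  assumes T: "operator_on X N T" and f: "\<And>n. f n \<in> X" and s: "series f A s"
  shows "series (\<lambda>n. T (f n)) A (T s)"
  using operator_tends_to[OF T s[unfolded has_series_sum_def]]
  unfolding has_series_sum_def by (simp add: operator_sum[OF T f])

text \<open>
  Used for an index \<open>m\<close> that belongs to the set of return times: it turns a series without the term
  \<open>m\<close>, as in the smallness condition, into the full series.
\<close>

lemma series_insert_term:
  assumes s: "series f (A - {m}) s" and m: "m \<in> A" "f m \<in> X"
  shows "series f A (s + f m)"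
proof -
  have "tends_to (\<lambda>M. (\<Sum>n\<in>(A - {m}) \<inter> {..<M}. f n) + f m) (s + f m) sequentially"
    using s m unfolding has_series_sum_def by (intro tends_to_add tends_to_const) auto
  moreover have "\<forall>\<^sub>F M in sequentially.
      (\<Sum>n\<in>(A - {m}) \<inter> {..<M}. f n) + f m = (\<Sum>n\<in>A \<inter> {..<M}. f n)"
    using eventually_gt_at_top[of m]
  proof eventually_elim
    case (elim M)
    then have "A \<inter> {..<M} = insert m ((A - {m}) \<inter> {..<M})" using m by auto
    then show ?case by (simp add: add.commute)
  qed
  ultimately show ?thesis
    unfolding has_series_sum_def using limitin_transform_eventually by fast
qed

end

section \<open>The shift in normalised coordinates\<close>

lemma shift_coeff_pred:
  fixes w :: "int \<Rightarrow> 'k::field"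
  assumes w: "\<And>n. w n \<noteq> 0"
  shows "w n * shift_coeff w n = shift_coeff w (n - 1)"
proof (cases "n > 0")
  case True
  then have "{1..n} = insert n {1..n - 1}" by auto
  then have "(\<Prod>i = 1..n. w i) = w n * (\<Prod>i = 1..n - 1. w i)" by simp
  then show ?thesis using True w[of n] by (auto simp: shift_coeff_def field_simps)
next
  case False
  then have "{n..0} = insert n {n + 1..0}" by auto
  then show ?thesis using False by (simp add: shift_coeff_def)
qed

lemma shift_coeff_nonzero:
  fixes w :: "int \<Rightarrow> 'k::field"
  assumes w: "\<And>n. w n \<noteq> 0"
  shows "shift_coeff w n \<noteq> 0"
  using w by (simp add: shift_coeff_def)

locale sequence_space_with_basis = banach_sequence_space X N
  for X :: "(int \<Rightarrow> 'k::{real_normed_field, euclidean_space}) set" and N +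
  assumes basis: "unit_basis X N"
begin

lemma unit_seq_mem: "unit_seq k \<in> X"
  using basis by (simp add: unit_basis_def)

lemma basis_symmetric_sums:
  assumes "x \<in> X"
  shows "tends_to (\<lambda>n. \<Sum>k = - int n..int n. seq_scale (x k) (unit_seq k)) x sequentially"
  unfolding tends_to_iff
proof (intro conjI allI impI)
  show "x \<in> X" by fact
  fix e :: real assume "e > 0"
  let ?S = "\<lambda>m n. \<Sum>k = - int m..int n. seq_scale (x k) (unit_seq k)"
  have "tends_to (\<lambda>(m, n). ?S m n) x (sequentially \<times>\<^sub>F sequentially)"
    using basis assms unfolding unit_basis_def by blast
  then have "\<forall>\<^sub>F p in sequentially \<times>\<^sub>F sequentially.
      (\<lambda>(m, n). ?S m n) p \<in> X \<and> N ((\<lambda>(m, n). ?S m n) p - x) < e"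
    using \<open>e > 0\<close> unfolding tends_to_iff by blast
  then obtain M where "\<And>m n. m \<ge> M \<Longrightarrow> n \<ge> M \<Longrightarrow> ?S n m \<in> X \<and> N (?S n m - x) < e"
    unfolding eventually_prod_sequentially by (auto simp only: prod.case)
  then show "\<forall>\<^sub>F n in sequentially. ?S n n \<in> X \<and> N (?S n n - x) < e"
    unfolding eventually_sequentially by blast
qed

end

locale weighted_shift = sequence_space_with_basis X N
  for X :: "(int \<Rightarrow> 'k::{real_normed_field, euclidean_space}) set" and N +
  fixes w :: "int \<Rightarrow> 'k"
  assumes weights_nonzero: "w n \<noteq> 0"
    and shift_operator: "operator_on X N (backward_shift w)"
begin

abbreviation "u k \<equiv> shift_term w k"
abbreviation "T \<equiv> backward_shift w"

lemma u_mem: "u k \<in> X"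
  by (simp add: scale_mem unit_seq_mem)

lemma shift_u: "T (u k) = u (k - 1)"
  using shift_coeff_pred[of w k, OF weights_nonzero]
  by (auto simp: fun_eq_iff seq_scale_apply backward_shift_def unit_seq_def)

lemma shift_pow_operator: "operator_on X N (T ^^ m)"
  by (rule operator_funpow[OF shift_operator])

lemma shift_pow_u: "(T ^^ m) (u k) = u (k - int m)"
  by (induction m) (simp_all add: shift_u algebra_simps)

lemma series_shift_pow:
  assumes "series (\<lambda>n. u (g n)) A s"
  shows "series (\<lambda>n. u (g n - int m)) A ((T ^^ m) s)"
  using series_operator[OF shift_pow_operator[of m] u_mem assms] by (simp add: shift_pow_u)

text \<open>
  For the index \<open>k\<close> the set \<open>A (p k)\<close> comes with the shift \<open>p k \<ge> k\<close>, and the power \<open>p k - k\<close> of the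
  backward shift turns it into the shift \<open>k\<close>.
\<close>

lemma shifted_series_converge_subsequence:
  assumes A: "shifted_series_converge X N w A" and p: "strict_mono p"
  shows "shifted_series_converge X N w (\<lambda>k. A (p k))"
  unfolding shifted_series_converge_def
proof (intro allI impI)
  fix k :: nat assume "k \<ge> 1"
  have k: "k \<le> p k" using seq_suble[OF p] .
  then have "p k \<ge> 1" using \<open>k \<ge> 1\<close> by linarith
  then obtain s where "series (\<lambda>n. u (int n + int (p k))) (A (p k)) s"
    using A unfolding shifted_series_converge_def by blast
  from series_shift_pow[OF this, of "p k - k"] k
  show "\<exists>s. series (\<lambda>n. u (int n + int k)) (A (p k)) s" by (auto simp: algebra_simps of_nat_diff)
qed

text \<open>
  Since \<open>k \<le> p k\<close>, the shifts \<open>\<bar>j\<bar> \<le> k\<close> are admissible for \<open>A (p k)\<close>; so the smallness condition is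
  inherited by a subsequence along which \<open>\<epsilon>\<close> lies below \<open>\<delta>\<close>.
\<close>

lemma condition_C_change_sequence:
  assumes \<epsilon>: "positive_null_sequence \<epsilon>" and \<delta>: "positive_null_sequence \<delta>"
    and C: "condition_C \<A> X N w \<epsilon>"
  shows "condition_C \<A> X N w \<delta>"
proof -
  obtain A where A: "disjoint_members \<A> A" "shifted_series_converge X N w A"
      "small_differences X N w (\<lambda>p. {- int p..int p}) \<epsilon> A"
    using C unfolding condition_C_def by blast
  define \<delta>' where "\<delta>' = (\<lambda>k. if k = 0 then 1 else \<delta> k)"
  have "0 < \<delta>' k" for k using \<delta> by (auto simp: positive_null_sequence_def \<delta>'_def)
  from null_sequence_subsequence[where \<delta> = \<delta>', OF \<epsilon> this, where h = "\<lambda>_. 0"]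
  obtain p where p: "strict_mono p" "\<And>k. \<epsilon> (p k) \<le> \<delta>' k" by blast
  have p_le: "\<epsilon> (p k) \<le> \<delta> k" if "k \<ge> 1" for k
    using p(2)[of k] that by (simp add: \<delta>'_def)
  have "small_differences X N w (\<lambda>p. {- int p..int p}) \<delta> (\<lambda>k. A (p k))"
    unfolding small_differences_def
  proof (intro allI impI ballI)
    fix k l m j assume k: "k \<ge> 1" and l: "l \<ge> 1" and m: "m \<in> A (p l)" and j: "j \<in> {- int k..int k}"
    have "k \<le> p k" "l \<le> p l" using seq_suble[OF p(1)] by auto
    then have "p k \<ge> 1" "p l \<ge> 1" "j \<in> {- int (p k)..int (p k)}" using k l j by auto
    then obtain s where "series (\<lambda>n. u (int n - int m + j)) (A (p k) - {m}) s"
        "N s < min (\<epsilon> (p k)) (\<epsilon> (p l))"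
      using A(3) m unfolding small_differences_def by blast
    then show "\<exists>s. series (\<lambda>n. u (int n - int m + j)) (A (p k) - {m}) s \<and> N s < min (\<delta> k) (\<delta> l)"
      using p_le[OF k] p_le[OF l] by (intro exI[of _ s]) auto
  qed
  then show ?thesis
    using disjoint_members_subsequence[OF A(1) p(1)] shifted_series_converge_subsequence[OF A(2) p(1)]
    unfolding condition_C_def by blast
qed

end

section \<open>Invertible shifts\<close>

locale invertible_weighted_shift = weighted_shift +
  fixes S :: "(int \<Rightarrow> 'a) \<Rightarrow> (int \<Rightarrow> 'a)"
  assumes inverse_operator: "operator_on X N S"
    and inverse_shift: "x \<in> X \<Longrightarrow> S (T x) = x"
begin

lemma inverse_u: "S (u k) = u (k + 1)"
  using inverse_shift[OF u_mem[of "k + 1"]] by (simp add: shift_u)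

text \<open>
  The integer powers of the inverse of the shift.
\<close>

definition translation :: "int \<Rightarrow> (int \<Rightarrow> 'a) \<Rightarrow> (int \<Rightarrow> 'a)"
  where "translation j = (if j \<ge> 0 then S ^^ nat j else T ^^ nat (- j))"

lemma translation_operator: "operator_on X N (translation j)"
  by (simp add: translation_def operator_funpow inverse_operator shift_operator)

lemma translation_u: "translation j (u k) = u (k + j)"
proof -
  have "(S ^^ m) (u k) = u (k + int m)" for m
    by (induction m) (simp_all add: inverse_u algebra_simps)
  then show ?thesis by (simp add: translation_def shift_pow_u)
qed

lemma series_translation:
  assumes "series (\<lambda>n. u (g n)) A s"
  shows "series (\<lambda>n. u (g n + j)) A (translation j s)"
  using series_operator[OF translation_operator[of j] u_mem assms] by (simp add: translation_u)

lemma shifted_iff_unshifted: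
  "shifted_series_converge X N w A \<longleftrightarrow> unshifted_series_converge X N w A"
proof -
  have "(\<exists>s. series (\<lambda>n. u (int n + int p)) (A p) s) \<longleftrightarrow> (\<exists>s. series (\<lambda>n. u (int n)) (A p) s)" for p
    using series_translation[of "\<lambda>n. int n" "A p" _ "int p"]
      series_translation[of "\<lambda>n. int n + int p" "A p" _ "- int p"] by auto
  then show ?thesis
    unfolding shifted_series_converge_def unshifted_series_converge_def by blast
qed

lemma translation_bounds:
  obtains M :: "nat \<Rightarrow> real" where "mono M" "\<And>k. 0 < M k"
    "\<And>k j x. \<bar>j\<bar> \<le> int k \<Longrightarrow> x \<in> X \<Longrightarrow> N (translation j x) \<le> M k * N x"
proof -
  have "\<exists>K. K > 0 \<and> (\<forall>x\<in>X. N (translation j x) \<le> K * N x)" for j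
    using operator_bound[OF translation_operator[of j]] by metis
  then obtain K where K: "\<And>j. K j > 0" "\<And>j x. x \<in> X \<Longrightarrow> N (translation j x) \<le> K j * N x" by metis
  let ?M = "\<lambda>k. \<Sum>j\<in>{- int k..int k}. K j"
  show ?thesis
  proof (rule that)
    show "mono ?M"
      using K(1) by (intro monoI sum_mono2) (auto intro: less_imp_le)
    show "0 < ?M k" for k using K(1) by (intro sum_pos) auto
    fix k j x assume j: "\<bar>j\<bar> \<le> int k" and x: "x \<in> X"
    have "K j \<le> ?M k" using j K(1) by (intro member_le_sum) (auto intro: less_imp_le)
    then show "N (translation j x) \<le> ?M k * N x"
      using K(2)[OF x, of j] mult_right_mono[OF _ norm_ge_zero[OF x]] by fastforce
  qed
qed

text \<open>
  A series with shift \<open>j\<close> is the image under \<open>translation j\<close> of the series with shift \<open>0\<close>, so it costs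
  a factor \<open>M k\<close> for \<open>\<bar>j\<bar> \<le> k\<close>. The new bound must hold with \<open>min (\<delta> k) (\<delta> l)\<close>, where \<open>M k\<close> is unrelated
  to \<open>l\<close>; this works because \<open>M\<close> increases and \<open>\<delta>\<close> decreases, so that the larger of the two indices
  decides.
\<close>

lemma condition_C_from_central_differences:
  assumes \<epsilon>: "positive_null_sequence \<epsilon>" and A: "disjoint_members \<A> A"
    and conv: "shifted_series_converge X N w A"
    and small: "small_differences X N w (\<lambda>p. {0}) \<epsilon> A"
  shows "condition_C \<A> X N w (\<lambda>k. 1 / real (Suc k))"
proof -
  obtain M :: "nat \<Rightarrow> real" where M: "mono M" "\<And>k. 0 < M k"
    "\<And>k j x. \<bar>j\<bar> \<le> int k \<Longrightarrow> x \<in> X \<Longrightarrow> N (translation j x) \<le> M k * N x"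
    using translation_bounds by blast
  define \<delta> where "\<delta> = (\<lambda>k. 1 / real (Suc k))"
  have \<delta>: "\<delta> k > 0" "k \<le> l \<Longrightarrow> \<delta> l \<le> \<delta> k" for k l by (simp_all add: \<delta>_def frac_le)
  have "0 < \<delta> k / M k" for k using M(2) \<delta> by simp
  from null_sequence_subsequence[where \<delta> = "\<lambda>k. \<delta> k / M k", OF \<epsilon> this, where h = "\<lambda>_. 0"]
  obtain p where p: "strict_mono p" "\<And>k. \<epsilon> (p k) \<le> \<delta> k / M k" by blast
  have p_max: "M k * \<epsilon> (p (max k l)) \<le> \<delta> (max k l)" if "k \<ge> 1" for k l
  proof -
    have "p (max k l) \<ge> 1" using seq_suble[OF p(1), of "max k l"] that by linarith
    then have "\<epsilon> (p (max k l)) > 0" using \<epsilon> by (simp add: positive_null_sequence_def)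
    then have "M k * \<epsilon> (p (max k l)) \<le> M (max k l) * \<epsilon> (p (max k l))"
      using monoD[OF M(1), of k "max k l"] by (simp add: mult_right_mono)
    also have "\<dots> \<le> \<delta> (max k l)" using p(2)[of "max k l"] M(2)[of "max k l"] by (simp add: field_simps)
    finally show ?thesis .
  qed
  have "small_differences X N w (\<lambda>p. {- int p..int p}) \<delta> (\<lambda>k. A (p k))"
    unfolding small_differences_def
  proof (intro allI impI ballI)
    fix k l m j assume k: "k \<ge> 1" and l: "l \<ge> 1" and m: "m \<in> A (p l)" and j: "j \<in> {- int k..int k}"
    have "k \<le> p k" "l \<le> p l" using seq_suble[OF p(1)] by auto
    then have "p k \<ge> 1" "p l \<ge> 1" using k l by auto
    then obtain s where s: "series (\<lambda>n. u (int n - int m + 0)) (A (p k) - {m}) s"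
        and Ns: "N s < min (\<epsilon> (p k)) (\<epsilon> (p l))"
      using small m unfolding small_differences_def by blast
    have "N (translation j s) \<le> M k * N s" using j by (intro M(3) series_mem[OF s]) auto
    also have "\<dots> < M k * \<epsilon> (p (max k l))" using Ns M(2) by (auto simp: max_def)
    also have "\<dots> \<le> \<delta> (max k l)" using p_max[OF k] .
    also have "\<dots> \<le> min (\<delta> k) (\<delta> l)" using \<delta>(2) by simp
    finally show "\<exists>s. series (\<lambda>n. u (int n - int m + j)) (A (p k) - {m}) s \<and> N s < min (\<delta> k) (\<delta> l)"
      using series_translation[OF s, of j] by auto
  qed
  then show ?thesis
    using disjoint_members_subsequence[OF A p(1)] shifted_series_converge_subsequence[OF conv p(1)]
    unfolding condition_C_def \<delta>_def by blast
qed

end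

section \<open>Points whose orbit follows prescribed targets\<close>

context banach_sequence_space
begin

lemma norm_combination_le:
  assumes "\<And>j. j \<in> J \<Longrightarrow> f j \<in> X" "\<And>j. j \<in> J \<Longrightarrow> N (f j) \<le> B"
  shows "N (\<Sum>j\<in>J. seq_scale (c j) (f j)) \<le> (\<Sum>j\<in>J. norm (c j)) * B"
proof -
  have "N (\<Sum>j\<in>J. seq_scale (c j) (f j)) \<le> (\<Sum>j\<in>J. N (seq_scale (c j) (f j)))"
    using assms(1) by (intro norm_sum_le scale_mem)
  also have "\<dots> = (\<Sum>j\<in>J. norm (c j) * N (f j))"
    using assms(1) by (intro sum.cong) (auto simp: norm_scale)
  also have "\<dots> \<le> (\<Sum>j\<in>J. norm (c j) * B)"
    using assms(2) by (intro sum_mono mult_left_mono) auto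
  finally show ?thesis by (simp only: sum_distrib_right)
qed

lemma scale_diff: "seq_scale (c::'k) x - seq_scale c y = seq_scale c (x - y)"
  by (simp add: fun_eq_iff seq_scale_apply algebra_simps)

lemma scale_diff_left: "seq_scale (c::'k) x - seq_scale d x = seq_scale (c - d) x"
  by (simp add: fun_eq_iff seq_scale_apply algebra_simps)

end

lemma countable_finitely_supported:
  fixes D :: "'a::zero set"
  assumes D: "countable D"
  shows "countable {f :: int \<Rightarrow> 'a. \<exists>M::nat. \<forall>j. if \<bar>j\<bar> \<le> int M then f j \<in> D else f j = 0}"
proof -
  let ?P = "\<lambda>M::nat. Pi\<^sub>E {- int M..int M} (\<lambda>_. D)"
  let ?ext = "\<lambda>M f j. if \<bar>j\<bar> \<le> int M then f j else (0::'a)"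
  have "countable (\<Union>M. ?ext M ` ?P M)"
    using D by (intro countable_UN countable_image countable_PiE) auto
  moreover have "{f :: int \<Rightarrow> 'a. \<exists>M::nat. \<forall>j. if \<bar>j\<bar> \<le> int M then f j \<in> D else f j = 0}
      \<subseteq> (\<Union>M. ?ext M ` ?P M)"
  proof clarify
    fix f :: "int \<Rightarrow> 'a" and M :: nat
    assume f: "\<forall>j. if \<bar>j\<bar> \<le> int M then f j \<in> D else f j = 0"
    have "f = ?ext M (restrict f {- int M..int M})"
      using f by (fastforce simp: fun_eq_iff restrict_def split: if_splits)
    moreover have "restrict f {- int M..int M} \<in> ?P M"
      using f by (auto split: if_splits)
    ultimately show "f \<in> (\<Union>M. ?ext M ` ?P M)" by blast
  qed
  ultimately show ?thesis by (rule countable_subset[rotated])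
qed

context weighted_shift
begin

lemma unit_seq_eq_u: "seq_scale c (unit_seq k) = seq_scale (c / shift_coeff w k) (u k)"
  using shift_coeff_nonzero[of w k, OF weights_nonzero]
  by (simp add: seq_scale_seq_scale)

definition target :: "(nat \<Rightarrow> int \<Rightarrow> 'k) \<Rightarrow> nat \<Rightarrow> (int \<Rightarrow> 'k)"
  where "target a l = (\<Sum>j = - int l..int l. seq_scale (a l j) (u j))"

lemma target_mem: "target a l \<in> X"
  unfolding target_def by (intro sum_mem scale_mem u_mem)

text \<open>
  Finite combinations of the \<open>u j\<close> with coefficients in a countable dense set of scalars are dense.
  They are enumerated with each one recurring at arbitrarily late positions \<open>l\<close>, because the
  orbit follows late targets more closely and because the support must fit into \<open>[-l, l]\<close>.
\<close>

lemma dense_targets_exist: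
  "\<exists>a. \<forall>x\<in>X. \<forall>e>0. \<forall>L. \<exists>l\<ge>L. N (target a l - x) < e"
proof -
  obtain D :: "'k set" where D: "countable D" "\<And>U. open U \<Longrightarrow> U \<noteq> {} \<Longrightarrow> \<exists>d\<in>D. d \<in> U"
    using countable_dense_exists by blast
  define F where "F = {f :: int \<Rightarrow> 'k. \<exists>M::nat. \<forall>j. if \<bar>j\<bar> \<le> int M then f j \<in> D else f j = 0}"
  have F: "countable F" unfolding F_def using D(1) by (rule countable_finitely_supported)
  define a where "a l = from_nat_into F (fst (prod_decode l))" for l
  have "\<exists>l\<ge>L. N (target a l - x) < e" if x: "x \<in> X" and e: "e > 0" for x e L
  proof -
    let ?S = "\<lambda>n. \<Sum>j = - int n..int n. seq_scale (x j) (unit_seq j)"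
    have "e / 2 > 0" using e by simp
    then obtain M :: nat where M: "N (?S M - x) < e / 2"
      using basis_symmetric_sums[OF x] unfolding tends_to_iff eventually_sequentially by blast
    define c where "c = (\<Sum>j = - int M..int M. N (u j)) + 1"
    have c: "c > 0" unfolding c_def by (intro add_nonneg_pos sum_nonneg norm_ge_zero u_mem) auto
    have "\<exists>d\<in>D. norm (d - x j / shift_coeff w j) < e / 2 / c" for j
      using D(2)[of "ball (x j / shift_coeff w j) (e / 2 / c)"] c e
      by (auto simp: dist_norm norm_minus_commute not_le)
    then have "\<exists>d. \<forall>j. d j \<in> D \<and> norm (d j - x j / shift_coeff w j) < e / 2 / c"
      by (intro choice allI) blast
    then obtain d where d: "\<And>j. d j \<in> D" "\<And>j. norm (d j - x j / shift_coeff w j) < e / 2 / c"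
      by blast
    define f where "f = (\<lambda>j. if \<bar>j\<bar> \<le> int M then d j else 0)"
    have "f \<in> F" unfolding F_def f_def using d(1) by auto
    then obtain i where i: "from_nat_into F i = f" using from_nat_into_surj[OF F] by blast
    define l where "l = prod_encode (i, max L M)"
    have l: "max L M \<le> l" unfolding l_def by (rule le_prod_encode_2)
    have al: "a l = f" by (simp add: a_def l_def i)
    have "target a l = (\<Sum>j = - int M..int M. seq_scale (d j) (u j))"
      unfolding target_def al using l by (intro sum.mono_neutral_cong_right) (auto simp: f_def)
    moreover have "?S M = (\<Sum>j = - int M..int M. seq_scale (x j / shift_coeff w j) (u j))"
      by (intro sum.cong refl unit_seq_eq_u)
    ultimately have "target a l - ?S M = (\<Sum>j = - int M..int M. seq_scale (d j - x j / shift_coeff w j) (u j))"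
      by (simp only: sum_subtractf[symmetric] scale_diff_left)
    then have "N (target a l - ?S M) \<le> (\<Sum>j = - int M..int M. norm (d j - x j / shift_coeff w j) * N (u j))"
      using norm_sum_le[of "{- int M..int M}" "\<lambda>j. seq_scale (d j - x j / shift_coeff w j) (u j)"]
      by (simp only: norm_scale[OF u_mem] scale_mem[OF u_mem])
    also have "\<dots> \<le> (\<Sum>j = - int M..int M. e / 2 / c * N (u j))"
      using d(2) by (intro sum_mono mult_right_mono less_imp_le norm_ge_zero[OF u_mem])
    also have "\<dots> = e / 2 / c * (c - 1)" by (simp only: sum_distrib_left[symmetric] c_def) simp
    also have "\<dots> \<le> e / 2" using c e by (simp add: field_simps)
    finally have "N (target a l - ?S M) \<le> e / 2" .
    moreover have "N (target a l - x) \<le> N (target a l - ?S M) + N (?S M - x)"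
      using norm_triangle[of "target a l - ?S M" "?S M - x"]
      by (simp add: diff_mem sum_mem scale_mem unit_seq_mem target_mem x)
    ultimately show ?thesis using M l by (intro exI[of _ l]) auto
  qed
  then show ?thesis by blast
qed

text \<open>
  The vector is \<open>x = (\<Sum>k. z k)\<close> with \<open>z k\<close> the target \<open>k\<close> copied to all positions \<open>n \<in> B k\<close>. Applying
  \<open>T ^^ m\<close> with \<open>m \<in> B l\<close> moves one copy of target \<open>l\<close> to the origin. All other copies contribute
  sums that \<open>diff\<close> bounds, and their total is geometrically small in \<open>l\<close>.
\<close>

lemma orbit_near_targets:
  assumes disj: "\<And>k l. k \<noteq> l \<Longrightarrow> B k \<inter> B l = {}"
    and initial: "\<And>k j. \<bar>j\<bar> \<le> int k \<Longrightarrow>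
      \<exists>s. series (\<lambda>n. u (int n + j)) (B k) s \<and> N s \<le> \<epsilon> k"
    and diff: "\<And>k l m j. m \<in> B l \<Longrightarrow> \<bar>j\<bar> \<le> int k \<Longrightarrow>
      \<exists>s. series (\<lambda>n. u (int n - int m + j)) (B k - {m}) s \<and> N s \<le> min (\<epsilon> k) (\<epsilon> l)"
    and weights: "\<And>k l. (\<Sum>j = - int k..int k. norm (a k j)) * min (\<epsilon> k) (\<epsilon> l) \<le> (1/2)^k * (1/2)^l"
    and weights0: "\<And>k. (\<Sum>j = - int k..int k. norm (a k j)) * \<epsilon> k \<le> (1/2)^k"
  shows "\<exists>x\<in>X. \<forall>l. \<forall>m\<in>B l. N ((T ^^ m) x - target a l) \<le> 2 * (1/2)^l"
proof -
  define s where "s k j = (SOME s. series (\<lambda>n. u (int n + j)) (B k) s \<and> N s \<le> \<epsilon> k)" for k j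
  have s: "series (\<lambda>n. u (int n + j)) (B k) (s k j)" "N (s k j) \<le> \<epsilon> k" if "\<bar>j\<bar> \<le> int k" for k j
    using someI_ex[OF initial[OF that]] unfolding s_def by blast+
  have s_mem: "s k j \<in> X" if "\<bar>j\<bar> \<le> int k" for k j using series_mem[OF s(1)[OF that]] .
  define z where "z k = (\<Sum>j = - int k..int k. seq_scale (a k j) (s k j))" for k
  have z_mem: "z k \<in> X" for k unfolding z_def using s_mem by (intro sum_mem scale_mem) auto
  have z_le: "N (z k) \<le> (1/2)^k" for k
    using s(2) s_mem unfolding z_def
    by (intro order_trans[OF norm_combination_le[where B = "\<epsilon> k"] weights0]) auto
  have geom: "summable (\<lambda>k. (1/2::real)^k)" by (simp add: summable_geometric)
  obtain x where x: "tends_to (\<lambda>n. \<Sum>k<n. z k) x sequentially"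
    using absolutely_convergent_series[OF z_mem z_le geom] by blast
  have "N ((T ^^ m) x - target a l) \<le> 2 * (1/2)^l" if m: "m \<in> B l" for l m
  proof -
    note Tm = shift_pow_operator[of m]
    define t where "t k j = (T ^^ m) (s k j) - (if k = l then u j else 0)" for k j
    have t: "t k j \<in> X \<and> N (t k j) \<le> min (\<epsilon> k) (\<epsilon> l)" if j: "\<bar>j\<bar> \<le> int k" for k j
    proof -
      obtain r where r: "series (\<lambda>n. u (int n - int m + j)) (B k - {m}) r" "N r \<le> min (\<epsilon> k) (\<epsilon> l)"
        using diff[OF m j] by blast
      have Ts: "series (\<lambda>n. u (int n - int m + j)) (B k) ((T ^^ m) (s k j))"
        using series_shift_pow[OF s(1)[OF j], of m] by (simp add: algebra_simps)
      have "(T ^^ m) (s k j) = r + (if k = l then u j else 0)"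
      proof (cases "k = l")
        case True
        then have "series (\<lambda>n. u (int n - int m + j)) (B k) (r + u j)"
          using series_insert_term[OF r(1)] m u_mem by simp
        from series_unique[OF Ts this] True show ?thesis by simp
      next
        case False
        then have "B k - {m} = B k" using disj[of k l] m by blast
        with series_unique[OF Ts] r(1) False show ?thesis by simp
      qed
      then have "t k j = r" by (simp add: t_def)
      with r series_mem show ?thesis by blast
    qed
    define r where "r k = (T ^^ m) (z k) - (if k = l then target a l else 0)" for k
    have r: "r k = (\<Sum>j = - int k..int k. seq_scale (a k j) (t k j))" for k
    proof -
      have "(T ^^ m) (z k) = (\<Sum>j = - int k..int k. seq_scale (a k j) ((T ^^ m) (s k j)))"
        unfolding z_def using s_mem
        by (subst operator_sum[OF Tm]) (auto intro!: scale_mem sum.cong operator_scale[OF Tm])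
      moreover have "(if k = l then target a l else 0) =
          (\<Sum>j = - int k..int k. seq_scale (a k j) (if k = l then u j else 0))"
        by (auto simp: target_def fun_eq_iff seq_scale_apply sum_seq_apply)
      ultimately show ?thesis
        by (simp only: r_def t_def scale_diff sum_subtractf[symmetric])
    qed
    have r_mem: "r k \<in> X" for k unfolding r using t by (intro sum_mem scale_mem) auto
    have r_le: "N (r k) \<le> (1/2)^k * (1/2)^l" for k
      unfolding r using t by (intro order_trans[OF norm_combination_le weights]) auto
    obtain y where y: "tends_to (\<lambda>n. \<Sum>k<n. r k) y sequentially" "N y \<le> (\<Sum>k. (1/2)^k * (1/2)^l)"
      using absolutely_convergent_series[OF r_mem r_le summable_mult2[OF geom]] by blast
    have "tends_to (\<lambda>n. (\<Sum>k<n. (T ^^ m) (z k)) + - target a l) ((T ^^ m) x + - target a l) sequentially"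
      using operator_tends_to[OF Tm x] target_mem
      by (intro tends_to_add tends_to_const uminus_mem) (simp_all add: operator_sum[OF Tm z_mem])
    moreover have "\<forall>\<^sub>F n in sequentially. (\<Sum>k<n. (T ^^ m) (z k)) + - target a l = (\<Sum>k<n. r k)"
      using eventually_gt_at_top[of l]
    proof eventually_elim
      case (elim n)
      have "(\<Sum>k<n. if k = l then target a l else 0) = target a l" using elim by simp
      then show ?case by (simp only: r_def sum_subtractf) simp
    qed
    ultimately have "tends_to (\<lambda>n. \<Sum>k<n. r k) ((T ^^ m) x + - target a l) sequentially"
      by (rule limitin_transform_eventually[rotated])
    then have "y = (T ^^ m) x - target a l" using tends_to_unique[OF y(1)] by simp
    moreover have "(\<Sum>k. (1/2::real)^k * (1/2)^l) = 2 * (1/2)^l"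
      by (simp add: suminf_mult2[OF geom, symmetric] suminf_geometric)
    ultimately show ?thesis using y(2) by simp
  qed
  then show ?thesis using tends_to_mem[OF x] by blast
qed

text \<open>
  The sequence \<open>\<delta>\<close> is chosen with the coefficient sums \<open>K\<close> of the first targets in its denominator, so that
  the error of block \<open>k\<close> near target \<open>l\<close> is at most \<open>(1/4) ^ max k l \<le> (1/2) ^ k * (1/2) ^ l\<close>.
\<close>

lemma family_hypercyclic_if_condition_C:
  assumes fam: "furstenberg_family \<A>" and \<epsilon>: "positive_null_sequence \<epsilon>"
    and C: "condition_C \<A> X N w \<epsilon>"
  shows "family_hypercyclic \<A> X N T"
\<comment> \<open>If the family contains the empty set, it contains every set and any vector will do.
  Otherwise each \<open>A p\<close> has an element, which is needed to bound the initial sums.\<close>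
proof (cases "{} \<in> \<A>")
  case True
  then have "V \<in> \<A>" for V using fam unfolding furstenberg_family_def by blast
  then show ?thesis unfolding family_hypercyclic_def using zero_mem by blast
next
  case nonempty: False
  obtain A where A: "disjoint_members \<A> A" "small_differences X N w (\<lambda>p. {- int p..int p}) \<epsilon> A"
    using C unfolding condition_C_def by blast
  have A_mem: "A p \<in> \<A>" if "p \<ge> 1" for p using A(1) that by (simp add: disjoint_members_def)
  have upward: "V \<in> \<A> \<Longrightarrow> V \<subseteq> W \<Longrightarrow> W \<in> \<A>" for V W
    using fam unfolding furstenberg_family_def by blast
  have A_disj: "A p \<inter> A q = {}" if "p \<ge> 1" "q \<ge> 1" "p \<noteq> q" for p q
    using A(1) that unfolding disjoint_members_def disjoint_family_on_def by auto
  obtain m0 where m0: "m0 \<in> A 1" using A_mem[of 1] nonempty by fastforce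
  obtain a where a: "\<And>x e L. x \<in> X \<Longrightarrow> e > 0 \<Longrightarrow> \<exists>l\<ge>L. N (target a l - x) < e"
    using dense_targets_exist by blast
  define K where "K k = (\<Sum>j = - int k..int k. norm (a k j))" for k
  define \<delta> where "\<delta> k = (1/4)^k / (1 + (\<Sum>i\<le>k. K i))" for k
  have K: "K k \<ge> 0" for k unfolding K_def by (intro sum_nonneg) auto
  have den: "1 + (\<Sum>i\<le>k. K i) > 0" for k using K by (intro add_pos_nonneg sum_nonneg) auto
  have \<delta>_pos: "\<delta> k > 0" for k unfolding \<delta>_def using den[of k] by simp
  have K_le: "K i * \<delta> k \<le> (1/4)^k" if "i \<le> k" for i k
  proof -
    have "K i \<le> (\<Sum>i\<le>k. K i)" using that K by (intro member_le_sum) auto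
    then have "K i * (1/4)^k \<le> (1 + (\<Sum>i\<le>k. K i)) * (1/4)^k" by (intro mult_right_mono) auto
    then show ?thesis using den[of k] unfolding \<delta>_def by (simp add: divide_le_eq mult.commute)
  qed
  have quarter: "(1/4::real)^max k l \<le> (1/2)^k * (1/2)^l" for k l :: nat
  proof -
    have "(1/4::real)^max k l = (1/2)^(max k l + max k l)"
      by (simp add: power_add power_mult_distrib[symmetric])
    also have "\<dots> \<le> (1/2)^(k + l)" by (intro power_decreasing) auto
    finally show ?thesis by (simp add: power_add)
  qed
  obtain p where p: "strict_mono p" "\<And>k. \<epsilon> (p k) \<le> \<delta> k" "\<And>k. m0 + k + 2 \<le> p k"
    using null_sequence_subsequence[where \<delta> = \<delta> and h = "\<lambda>k. m0 + k + 2", OF \<epsilon> \<delta>_pos] by blast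
  have p1: "p k \<ge> 1" "p k \<noteq> 1" "k \<le> p k" for k using p(3)[of k] by auto
  have "\<exists>x\<in>X. \<forall>l. \<forall>m\<in>A (p l). N ((T ^^ m) x - target a l) \<le> 2 * (1/2)^l"
  proof (rule orbit_near_targets[where \<epsilon> = \<delta>])
    show "A (p k) \<inter> A (p l) = {}" if "k \<noteq> l" for k l
      using that p1 by (intro A_disj) (auto simp: strict_mono_eq[OF p(1)])
    show "\<exists>s. series (\<lambda>n. u (int n + j)) (A (p k)) s \<and> N s \<le> \<delta> k" if j: "\<bar>j\<bar> \<le> int k" for k j
    proof -
      \<comment> \<open>The shift \<open>m0 + j\<close> cancels the translation by \<open>m0 \<in> A 1\<close>, and \<open>m0 \<notin> A (p k)\<close> by disjointness;
        the smallness condition therefore speaks of the untranslated series.\<close>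
      have "int m0 + j \<in> {- int (p k)..int (p k)}" using j p(3)[of k] by auto
      then obtain s where "series (\<lambda>n. u (int n - int m0 + (int m0 + j))) (A (p k) - {m0}) s"
          "N s < min (\<epsilon> (p k)) (\<epsilon> 1)"
        using A(2) m0 p1(1)[of k] unfolding small_differences_def by blast
      moreover have "A (p k) - {m0} = A (p k)" using A_disj[of "p k" 1] p1[of k] m0 by blast
      ultimately show ?thesis using p(2)[of k] by (intro exI[of _ s]) auto
    qed
    show "\<exists>s. series (\<lambda>n. u (int n - int m + j)) (A (p k) - {m}) s \<and> N s \<le> min (\<delta> k) (\<delta> l)"
      if m: "m \<in> A (p l)" and j: "\<bar>j\<bar> \<le> int k" for k l m j
    proof -
      have "j \<in> {- int (p k)..int (p k)}" using j p1(3)[of k] by auto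
      then obtain s where "series (\<lambda>n. u (int n - int m + j)) (A (p k) - {m}) s"
          "N s < min (\<epsilon> (p k)) (\<epsilon> (p l))"
        using A(2) m p1(1)[of k] p1(1)[of l] unfolding small_differences_def by blast
      then show ?thesis using p(2)[of k] p(2)[of l] by (intro exI[of _ s]) auto
    qed
    show "(\<Sum>j = - int k..int k. norm (a k j)) * min (\<delta> k) (\<delta> l) \<le> (1/2)^k * (1/2)^l" for k l
    proof -
      have "K k * min (\<delta> k) (\<delta> l) \<le> K k * \<delta> (max k l)"
        using K by (intro mult_left_mono) (auto simp: max_def)
      also have "\<dots> \<le> (1/4)^max k l" by (intro K_le) simp
      finally show ?thesis using quarter[of k l] unfolding K_def by linarith
    qed
    show "(\<Sum>j = - int k..int k. norm (a k j)) * \<delta> k \<le> (1/2)^k" for k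
      using K_le[of k k] quarter[of k 0] unfolding K_def by simp
  qed
  then obtain x where x: "x \<in> X" "\<And>l m. m \<in> A (p l) \<Longrightarrow> N ((T ^^ m) x - target a l) \<le> 2 * (1/2)^l" by blast
  have "{n. (T ^^ n) x \<in> U} \<in> \<A>" if U: "openin (norm_topology X N) U" "U \<noteq> {}" for U
  proof -
    obtain y r where y: "y \<in> U" "y \<in> X" and r: "r > 0" "\<And>z. z \<in> X \<Longrightarrow> N (z - y) < r \<Longrightarrow> z \<in> U"
      using U unfolding openin_norm_topology by blast
    obtain L where L: "(1/2::real)^L < r / 4" using real_arch_pow_inv[of "r/4" "1/2"] r by auto
    obtain l where l: "l \<ge> L" "N (target a l - y) < r / 2" using a[OF y(2), of "r/2" L] r by auto
    have "(1/2::real)^l \<le> (1/2)^L" using l(1) by (intro power_decreasing) auto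
    then have near: "2 * (1/2::real)^l < r / 2" using L by linarith
    have "(T ^^ m) x \<in> U" if "m \<in> A (p l)" for m
    proof (rule r(2))
      show mem: "(T ^^ m) x \<in> X" using operator_mem[OF shift_pow_operator x(1)] .
      have "N ((T ^^ m) x - y) \<le> N ((T ^^ m) x - target a l) + N (target a l - y)"
        using norm_triangle[of "(T ^^ m) x - target a l" "target a l - y"] mem y(2) target_mem
        by (simp add: diff_mem)
      then show "N ((T ^^ m) x - y) < r" using x(2)[OF that] near l(2) by linarith
    qed
    then have "A (p l) \<subseteq> {n. (T ^^ n) x \<in> U}" by blast
    then show ?thesis by (rule upward[OF A_mem[OF p1(1)]])
  qed
  then show ?thesis unfolding family_hypercyclic_def using x(1) by blast
qed

end

section \<open>Unconditional bases\<close>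

text \<open>
  Rearrangements are built in steps, each of which may append a whole block of indices; this lemma
  passes to the limit of such a construction.
\<close>

lemma enumeration_through_lists:
  fixes L :: "nat \<Rightarrow> 'a list"
  assumes dist: "\<And>n. distinct (L n)"
    and extend: "\<And>n. \<exists>zs. zs \<noteq> [] \<and> L (Suc n) = L n @ zs"
    and cover: "\<And>x. \<exists>n. x \<in> set (L n)"
  shows "\<exists>\<sigma>. bij \<sigma> \<and> (\<forall>n. \<forall>i<length (L n). \<sigma> i = L n ! i)"
proof -
  have prefix: "\<exists>zs. L (n + d) = L n @ zs" for n d
  proof (induction d)
    case (Suc d)
    then show ?case using extend[of "n + d"] by auto
  qed auto
  have len: "n \<le> length (L n)" for n
  proof (induction n)
    case (Suc n)
    obtain zs where "zs \<noteq> []" "L (Suc n) = L n @ zs" using extend by blast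
    with Suc show ?case by (cases zs) auto
  qed auto
  define \<sigma> where "\<sigma> i = L (Suc i) ! i" for i
  have agree: "L n ! i = L m ! i" if "n \<le> m" "i < length (L n)" for n m i
    using prefix[of n "m - n"] that by (auto simp: nth_append)
  have \<sigma>: "\<sigma> i = L n ! i" if "i < length (L n)" for i n
  proof (cases "n \<le> Suc i")
    case True
    from agree[OF this that] show ?thesis by (simp only: \<sigma>_def)
  next
    case False
    then have "Suc i \<le> n" "i < length (L (Suc i))" using len[of "Suc i"] by simp_all
    from agree[OF this] show ?thesis by (simp only: \<sigma>_def)
  qed
  have "inj \<sigma>"
  proof (rule injI)
    fix i j assume eq: "\<sigma> i = \<sigma> j"
    define n where "n = Suc (max i j)"
    have "i < length (L n)" "j < length (L n)" using len[of n] by (auto simp: n_def)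
    then show "i = j" using eq \<sigma> dist[of n] by (auto simp: nth_eq_iff_index_eq)
  qed
  moreover have "surj \<sigma>"
  proof (rule surjI[of _ "\<lambda>x. SOME i. \<sigma> i = x"])
    fix x
    obtain n where "x \<in> set (L n)" using cover by blast
    then obtain i where "i < length (L n)" "x = L n ! i" by (auto simp: in_set_conv_nth)
    then have "\<exists>i. \<sigma> i = x" using \<sigma> by auto
    then show "\<sigma> (SOME i. \<sigma> i = x) = x" by (rule someI_ex)
  qed
  ultimately have "bij \<sigma>" by (rule bijI)
  then show ?thesis using \<sigma> by blast
qed

context banach_sequence_space
begin

text \<open>
  With \<open>0 \<le> t k \<le> 1\<close> the sum is a convex combination of the subset sums, the vertices of the cube of
  multipliers. The vector \<open>y\<close> collects the terms already treated in the induction.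
\<close>

lemma norm_convex_combination_le:
  assumes "finite F" and t: "\<And>k. k \<in> F \<Longrightarrow> 0 \<le> t k \<and> t k \<le> 1" and f: "\<And>k. k \<in> F \<Longrightarrow> f k \<in> X"
    and y: "y \<in> X" and le: "\<And>G. G \<subseteq> F \<Longrightarrow> N (y + sum f G) \<le> M"
  shows "N (y + (\<Sum>k\<in>F. seq_scale (of_real (t k)) (f k))) \<le> M"
  using assms
proof (induction F arbitrary: y rule: finite_induct)
  case empty
  then show ?case using empty(4)[of "{}"] by simp
next
  case (insert a F)
  let ?S = "\<Sum>k\<in>F. seq_scale (of_real (t k)) (f k)"
  have fa: "f a \<in> X" and S: "?S \<in> X" using insert.prems(2) by (auto intro!: sum_mem scale_mem)
  have 1: "N (y + ?S) \<le> M"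
    using insert.prems by (intro insert.IH) auto
  have 2: "N (y + f a + ?S) \<le> M"
  proof (rule insert.IH)
    fix G assume G: "G \<subseteq> F"
    then have aG: "a \<notin> G" "finite G" using insert.hyps finite_subset by auto
    have "y + f a + sum f G = y + sum f (insert a G)"
      by (simp only: sum.insert[OF aG(2,1)] add.assoc)
    moreover have "N (y + sum f (insert a G)) \<le> M" using G by (intro insert.prems(4)) auto
    ultimately show "N (y + f a + sum f G) \<le> M" by (simp only:)
  next
    show "y + f a \<in> X" by (rule add_mem[OF insert.prems(3) fa])
  qed (use insert.prems in auto)
  have t: "0 \<le> t a" "t a \<le> 1" using insert.prems(1)[of a] by auto
  have "y + (\<Sum>k\<in>insert a F. seq_scale (of_real (t k)) (f k)) =
      seq_scale (of_real (1 - t a)) (y + ?S) + seq_scale (of_real (t a)) (y + f a + ?S)"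
    using insert.hyps by (simp add: fun_eq_iff seq_scale_apply algebra_simps)
  then have "N (y + (\<Sum>k\<in>insert a F. seq_scale (of_real (t k)) (f k))) =
      N (seq_scale (of_real (1 - t a)) (y + ?S) + seq_scale (of_real (t a)) (y + f a + ?S))"
    by (rule arg_cong)
  also have "\<dots> \<le> (1 - t a) * N (y + ?S) + t a * N (y + f a + ?S)"
    using t insert.prems(3) fa S
    by (intro order_trans[OF norm_triangle]) (simp_all add: norm_scale add_mem scale_mem del: of_real_diff)
  also have "\<dots> \<le> (1 - t a) * M + t a * M" using t 1 2 by (intro add_mono mult_left_mono) auto
  also have "(1 - t a) * M + t a * M = M" by (simp add: algebra_simps)
  finally show ?case .
qed

end

context sequence_space_with_basis
begin

definition proj :: "int set \<Rightarrow> (int \<Rightarrow> 'k) \<Rightarrow> (int \<Rightarrow> 'k)"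
  where "proj F x = (\<Sum>k\<in>F. seq_scale (x k) (unit_seq k))"

lemma proj_mem: "proj F x \<in> X"
  unfolding proj_def by (intro sum_mem scale_mem unit_seq_mem)

lemma proj_diff: "proj F (x - y) = proj F x - proj F y"
  by (simp add: proj_def fun_eq_iff sum_seq_apply seq_scale_apply sum_subtractf algebra_simps)

lemma proj_scale: "proj F (seq_scale c x) = seq_scale c (proj F x)"
  by (simp add: proj_def fun_eq_iff sum_seq_apply seq_scale_apply sum_distrib_left algebra_simps)

lemma proj_apply: "finite F \<Longrightarrow> proj F x k = (if k \<in> F then x k else 0)"
  by (simp add: proj_def sum_seq_apply seq_scale_apply unit_seq_def if_distrib cong: if_cong)

lemma proj_bounded: "\<exists>K. \<forall>x\<in>X. N (proj F x) \<le> K * N x"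
proof -
  define c where "c k = (SOME K. \<forall>x\<in>X. norm (x k) \<le> K * N x)" for k
  have c: "norm (x k) \<le> c k * N x" if "x \<in> X" for x k
    using someI_ex[OF coordinate_bound[of k]] that unfolding c_def by blast
  have "N (proj F x) \<le> (\<Sum>k\<in>F. c k * N (unit_seq k)) * N x" if x: "x \<in> X" for x
  proof -
    have "N (proj F x) \<le> (\<Sum>k\<in>F. norm (x k) * N (unit_seq k))"
      unfolding proj_def using norm_sum_le[of F "\<lambda>k. seq_scale (x k) (unit_seq k)"]
      by (simp only: norm_scale[OF unit_seq_mem] scale_mem[OF unit_seq_mem])
    also have "\<dots> \<le> (\<Sum>k\<in>F. c k * N x * N (unit_seq k))"
      using c[OF x] norm_ge_zero[OF unit_seq_mem] by (intro sum_mono mult_right_mono) auto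
    finally show ?thesis by (simp add: sum_distrib_left sum_distrib_right mult_ac)
  qed
  then show ?thesis by blast
qed

end

locale unconditional_sequence_space = sequence_space_with_basis +
  assumes unconditional: "unconditional_unit_basis X N"
begin

text \<open>
  Otherwise every finite set has a finite block of norm at least \<open>1\<close> outside it. Such blocks, listed
  one after another with the missing integers inserted in between, form a rearrangement whose
  partial sums are not Cauchy.
\<close>

lemma no_large_blocks:
  assumes x: "x \<in> X"
  shows "\<exists>G. finite G \<and> (\<forall>F. finite F \<longrightarrow> F \<inter> G = {} \<longrightarrow> N (proj F x) < 1)"
proof (rule ccontr)
  assume "\<not> ?thesis"
  then have blocks: "\<exists>F. finite F \<and> F \<inter> G = {} \<and> N (proj F x) \<ge> 1" if "finite G" for G
    using that by (meson not_le)
  have "\<exists>L. \<forall>n. distinct (L n) \<and> (\<exists>ys zs. L (Suc n) = L n @ ys @ zs \<and>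
      N (proj (set ys) x) \<ge> 1 \<and> int_decode n \<in> set (L (Suc n)))"
  proof (rule dependent_nat_choice)
    show "\<exists>l :: int list. distinct l" by (rule exI[of _ "[]"]) simp
    fix l :: "int list" and n :: nat assume l: "distinct l"
    obtain F where F: "finite F" "F \<inter> set l = {}" "N (proj F x) \<ge> 1" using blocks[of "set l"] by blast
    obtain ys where ys: "set ys = F" "distinct ys" using finite_distinct_list[OF F(1)] by blast
    define zs where "zs = (if int_decode n \<in> set (l @ ys) then [] else [int_decode n])"
    have "distinct (l @ ys @ zs)" "int_decode n \<in> set (l @ ys @ zs)"
      using l ys F by (auto simp: zs_def)
    then show "\<exists>l'. distinct l' \<and> (\<exists>ys zs. l' = l @ ys @ zs \<and> N (proj (set ys) x) \<ge> 1 \<and> int_decode n \<in> set l')"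
      using F(3) ys(1) by (intro exI[of _ "l @ ys @ zs"]) blast
  qed
  then obtain L where dist: "\<And>n. distinct (L n)"
    and step: "\<And>n. \<exists>ys zs. L (Suc n) = L n @ ys @ zs \<and> N (proj (set ys) x) \<ge> 1 \<and> int_decode n \<in> set (L (Suc n))"
    by blast
  have "\<exists>\<sigma>. bij \<sigma> \<and> (\<forall>n. \<forall>i<length (L n). \<sigma> i = L n ! i)"
  proof (rule enumeration_through_lists[OF dist])
    show "\<exists>zs. zs \<noteq> [] \<and> L (Suc n) = L n @ zs" for n
    proof -
      obtain ys zs where "L (Suc n) = L n @ ys @ zs" "N (proj (set ys) x) \<ge> 1" using step by blast
      then show ?thesis by (intro exI[of _ "ys @ zs"]) (auto simp: proj_def norm_zero)
    qed
    show "\<exists>n. k \<in> set (L n)" for k using step[of "int_encode k"] by auto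
  qed
  then obtain \<sigma> where \<sigma>: "bij \<sigma>" "\<And>n i. i < length (L n) \<Longrightarrow> \<sigma> i = L n ! i" by blast
  let ?f = "\<lambda>k. seq_scale (x k) (unit_seq k)"
  obtain s where "tends_to (\<lambda>n. \<Sum>i<n. ?f (\<sigma> i)) s sequentially"
    using unconditional x \<sigma>(1) unfolding unconditional_unit_basis_def by blast
  from tends_to_imp_Cauchy[OF this, of 1]
  obtain M where M: "\<And>m n. n \<ge> M \<Longrightarrow> m \<ge> M \<Longrightarrow> N ((\<Sum>i<m. ?f (\<sigma> i)) - (\<Sum>i<n. ?f (\<sigma> i))) < 1"
    by auto
  obtain ys zs where L: "L (Suc M) = L M @ ys @ zs" and ys: "N (proj (set ys) x) \<ge> 1" using step by blast
  have partial: "(\<Sum>i<length xs. ?f (\<sigma> i)) = proj (set xs) x" if "L (Suc M) = xs @ vs" for xs vs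
  proof -
    have "(\<Sum>i<length xs. ?f (\<sigma> i)) = (\<Sum>i<length xs. ?f (xs ! i))"
      using \<sigma>(2)[of _ "Suc M"] that by (intro sum.cong) (auto simp: nth_append)
    also have "\<dots> = sum_list (map ?f xs)" by (simp add: sum_list_sum_nth atLeast0LessThan)
    also have "\<dots> = proj (set xs) x"
      using dist[of "Suc M"] that by (simp add: sum_list_distinct_conv_sum_set proj_def)
    finally show ?thesis .
  qed
  have disj: "set (L M) \<inter> set ys = {}" using dist[of "Suc M"] L by auto
  have "proj (set (L M @ ys)) x = proj (set (L M)) x + proj (set ys) x"
    unfolding proj_def set_append using disj by (intro sum.union_disjoint) auto
  then have "N ((\<Sum>i<length (L M @ ys). ?f (\<sigma> i)) - (\<Sum>i<length (L M). ?f (\<sigma> i))) = N (proj (set ys) x)"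
    using partial[of "L M @ ys" zs] partial[of "L M" "ys @ zs"] L by simp
  moreover have "M \<le> length (L M)"
  proof -
    have "n \<le> length (L n)" for n
    proof (induction n)
      case (Suc n)
      obtain ys zs where "L (Suc n) = L n @ ys @ zs" "N (proj (set ys) x) \<ge> 1" using step by blast
      with Suc show ?case by (cases ys) (auto simp: proj_def norm_zero)
    qed auto
    then show ?thesis .
  qed
  ultimately show False using M[of "length (L M)" "length (L M @ ys)"] ys by simp
qed

lemma proj_pointwise_bounded:
  assumes x: "x \<in> X"
  shows "\<exists>B. \<forall>F. finite F \<longrightarrow> N (proj F x) \<le> B"
proof -
  obtain G where G: "finite G" "\<And>F. finite F \<Longrightarrow> F \<inter> G = {} \<Longrightarrow> N (proj F x) < 1"
    using no_large_blocks[OF x] by blast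
  let ?f = "\<lambda>k. seq_scale (x k) (unit_seq k)"
  have "N (proj F x) \<le> 1 + (\<Sum>k\<in>G. N (?f k))" if F: "finite F" for F
  proof -
    have "proj F x = proj (F - G) x + proj (F \<inter> G) x"
      unfolding proj_def using F
      by (subst sum.union_disjoint[symmetric]) (auto intro!: sum.cong)
    then have "N (proj F x) \<le> N (proj (F - G) x) + N (proj (F \<inter> G) x)"
      using norm_triangle proj_mem by simp
    also have "N (proj (F - G) x) < 1" using F by (intro G(2)) auto
    also have "N (proj (F \<inter> G) x) \<le> (\<Sum>k\<in>F \<inter> G. N (?f k))"
      unfolding proj_def by (intro norm_sum_le scale_mem unit_seq_mem)
    also have "\<dots> \<le> (\<Sum>k\<in>G. N (?f k))"
      using G(1) by (intro sum_mono2) (auto intro: norm_ge_zero scale_mem unit_seq_mem)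
    finally show ?thesis by simp
  qed
  then show ?thesis by blast
qed

text \<open>
  The Banach-Steinhaus argument: the closed sets \<open>E n\<close>, on which all projections are bounded by \<open>n\<close>,
  cover the complete space, so one of them contains a ball.
\<close>

lemma proj_uniformly_bounded:
  "\<exists>C>0. \<forall>x\<in>X. \<forall>F. finite F \<longrightarrow> N (proj F x) \<le> C * N x"
proof -
  define E where "E n = {x \<in> X. \<forall>F. finite F \<longrightarrow> N (proj F x) \<le> real n}" for n
  have closed: "closedin (norm_topology X N) (E n)" for n
  proof -
    have "\<exists>r>0. \<forall>y\<in>X. N (y - x) < r \<longrightarrow> y \<in> X - E n" if x: "x \<in> X - E n" for x
    proof -
      obtain F where F: "finite F" "N (proj F x) > real n" using x unfolding E_def by force
      obtain K where K: "\<And>y. y \<in> X \<Longrightarrow> N (proj F y) \<le> K * N y" using proj_bounded[of F] by blast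
      define r where "r = (N (proj F x) - real n) / (\<bar>K\<bar> + 1)"
      have r: "r > 0" unfolding r_def using F(2) by (intro divide_pos_pos) auto
      have "y \<in> X - E n" if y: "y \<in> X" "N (y - x) < r" for y
      proof -
        have xy: "x - y \<in> X" "N (x - y) < r" using x y norm_diff_commute by (auto simp: diff_mem)
        have "N (proj F x) - N (proj F y) \<le> N (proj F (x - y))"
          using norm_triangle_sub[OF proj_mem proj_mem, of F x F y] by (simp add: proj_diff)
        also have "\<dots> \<le> K * N (x - y)" using K xy(1) by blast
        also have "\<dots> \<le> (\<bar>K\<bar> + 1) * N (x - y)"
          using norm_ge_zero[OF xy(1)] by (intro mult_right_mono) auto
        also have "\<dots> < (\<bar>K\<bar> + 1) * r" using xy(2) by (intro mult_strict_left_mono) auto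
        also have "\<dots> = N (proj F x) - real n" by (simp add: r_def)
        finally have "N (proj F y) > real n" by simp
        then show ?thesis using F(1) y(1) by (auto simp: E_def not_le)
      qed
      then show ?thesis using r by blast
    qed
    then have "openin (norm_topology X N) (X - E n)" by (auto simp: openin_norm_topology)
    then show ?thesis by (auto simp: closedin_def E_def)
  qed
  have "\<exists>n. x \<in> E n" if x: "x \<in> X" for x
  proof -
    obtain B where B: "\<And>F. finite F \<Longrightarrow> N (proj F x) \<le> B" using proj_pointwise_bounded[OF x] by blast
    obtain n where "B \<le> real n" using real_arch_simple by blast
    then have "x \<in> E n" using B x unfolding E_def by force
    then show ?thesis ..
  qed
  then have "\<Union> (range E) = X" by (auto simp: E_def)
  then have "norm_topology X N interior_of \<Union> (range E) \<noteq> {}"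
    using zero_mem interior_of_topspace[of "norm_topology X N"] by auto
  then obtain n where "norm_topology X N interior_of (E n) \<noteq> {}"
    using metric.metric_Baire_category_alt[OF complete, of "range E"] closed
    by fastforce
  then obtain x0 where x0: "x0 \<in> norm_topology X N interior_of (E n)" by blast
  then obtain r where r: "r > 0"
    and "\<And>y. y \<in> X \<Longrightarrow> N (y - x0) < r \<Longrightarrow> y \<in> norm_topology X N interior_of (E n)"
    using openin_interior_of[of "norm_topology X N" "E n"] unfolding openin_norm_topology by blast
  then have ball: "y \<in> E n" if "y \<in> X" "N (y - x0) < r" for y
    using that interior_of_subset[of "norm_topology X N" "E n"] by blast
  have x0E: "x0 \<in> E n" using x0 interior_of_subset[of "norm_topology X N" "E n"] by blast
  then have x0X: "x0 \<in> X" by (simp add: E_def)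
  have bound: "N (proj F y) / (2 * real n + 1) < 1" if "finite F" "y \<in> X" "N y < r" for F y
  proof -
    have "x0 + y \<in> E n" using that x0X by (intro ball) (auto simp: add_mem)
    then have "N (proj F (x0 + y)) \<le> real n" "N (proj F x0) \<le> real n"
      using x0E that(1) by (auto simp: E_def)
    moreover have "proj F y = proj F (x0 + y) - proj F x0" by (simp only: proj_diff[symmetric]) simp
    ultimately have "N (proj F y) \<le> 2 * real n"
      using norm_diff_le[OF proj_mem proj_mem, of F "x0 + y" F x0] by simp
    then show ?thesis by simp
  qed
  have "N (proj F x) / (2 * real n + 1) \<le> 2 / r * N x" if "x \<in> X" "finite F" for x F
    using r bound that
    by (intro homogeneous_bound[where q = "\<lambda>x. N (proj F x) / (2 * real n + 1)"])
      (auto simp: proj_scale norm_scale proj_mem)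
  then have "N (proj F x) \<le> 2 / r * (2 * real n + 1) * N x" if "x \<in> X" "finite F" for x F
    using that by (force simp: divide_le_eq mult_ac)
  then show ?thesis using r by (intro exI[of _ "2 / r * (2 * real n + 1)"]) simp
qed

text \<open>
  Each scalar multiplier is split along the real basis of the scalar field, and each real part into
  its positive and negative part; this leaves multipliers in \<open>[0, 1]\<close>, to which convexity applies.
  The constant counts the \<open>2 * DIM\<close> pieces.
\<close>

lemma multiplier_bound:
  assumes C: "\<And>x F. x \<in> X \<Longrightarrow> finite F \<Longrightarrow> N (proj F x) \<le> C * N x"
    and x: "x \<in> X" and F: "finite F" and B: "B > 0" "\<And>k. k \<in> F \<Longrightarrow> norm (b k) \<le> B"
  shows "N (\<Sum>k\<in>F. seq_scale (b k * x k) (unit_seq k)) \<le> 2 * real DIM('a) * C * B * N x"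
proof -
  define g where "g k = seq_scale (x k) (unit_seq k)" for k
  have g: "g k \<in> X" for k by (simp add: g_def scale_mem unit_seq_mem)
  have real_mult: "N (\<Sum>k\<in>F. seq_scale (of_real (t k)) (g k)) \<le> C * N x"
    if "\<And>k. k \<in> F \<Longrightarrow> 0 \<le> t k \<and> t k \<le> 1" for t
    using norm_convex_combination_le[of F t g 0 "C * N x"] that C[OF x] finite_subset[OF _ F] F g zero_mem
    by (auto simp: proj_def g_def)
  define p where "p i k = max (b k \<bullet> i) 0 / B" for i k
  define q where "q i k = max (- (b k \<bullet> i)) 0 / B" for i k
  have coord: "\<bar>b k \<bullet> i\<bar> \<le> B" if "k \<in> F" "i \<in> Basis" for k i
    using Basis_le_norm[OF that(2), of "b k"] B(2)[OF that(1)] by linarith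
  have b: "b k = (\<Sum>i\<in>Basis. i * of_real B * (of_real (p i k) - of_real (q i k)))" for k
  proof -
    have "(of_real (p i k) - of_real (q i k) :: 'a) = of_real ((b k \<bullet> i) / B)" for i
      by (simp only: of_real_diff[symmetric] p_def q_def diff_divide_distrib[symmetric])
        (simp add: max_def)
    then have "i * of_real B * (of_real (p i k) - of_real (q i k)) = (b k \<bullet> i) *\<^sub>R i" for i
      using B(1) by (simp add: scaleR_conv_of_real)
    then show ?thesis by (simp only: euclidean_representation)
  qed
  have expand: "(\<Sum>k\<in>F. seq_scale (b k * x k) (unit_seq k)) = (\<Sum>i\<in>Basis. seq_scale (i * of_real B)
      ((\<Sum>k\<in>F. seq_scale (of_real (p i k)) (g k)) - (\<Sum>k\<in>F. seq_scale (of_real (q i k)) (g k))))"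
    (is "_ = (\<Sum>i\<in>Basis. seq_scale _ (?P i - ?Q i))")
  proof -
    have "seq_scale (b k * x k) (unit_seq k) = (\<Sum>i\<in>Basis. seq_scale (i * of_real B)
        (seq_scale (of_real (p i k)) (g k) - seq_scale (of_real (q i k)) (g k)))" for k
      by (subst b)
        (simp add: fun_eq_iff sum_seq_apply seq_scale_apply g_def sum_distrib_left sum_distrib_right algebra_simps)
    then show ?thesis
      by (simp only: seq_scale_sum sum_subtractf[symmetric]) (rule sum.swap)
  qed
  have "N (\<Sum>k\<in>F. seq_scale (b k * x k) (unit_seq k)) \<le>
      (\<Sum>i\<in>(Basis::'a set). norm (i * of_real B)) * (2 * C * N x)"
    unfolding expand
  proof (rule norm_combination_le)
    fix i :: 'a assume i: "i \<in> Basis"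
    have P: "?P i \<in> X" and Q: "?Q i \<in> X" using g by (auto intro!: sum_mem scale_mem)
    then show "?P i - ?Q i \<in> X" by (rule diff_mem)
    have "N (?P i) \<le> C * N x" using coord[OF _ i] B(1) by (intro real_mult) (fastforce simp: p_def)
    moreover have "N (?Q i) \<le> C * N x" using coord[OF _ i] B(1) by (intro real_mult) (fastforce simp: q_def)
    ultimately show "N (?P i - ?Q i) \<le> 2 * C * N x" using norm_diff_le[OF P Q] by simp
  qed
  also have "(\<Sum>i\<in>(Basis::'a set). norm (i * of_real B)) = real DIM('a) * B"
    using B(1) by (simp add: norm_mult)
  finally show ?thesis by (simp add: mult_ac)
qed

text \<open>
  In an unconditional basis the space is solid up to a constant: a sequence dominated by \<open>B\<close> times
  an element of the space defines a convergent series of comparable norm. The Cauchy property comes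
  from applying the estimate to \<open>x\<close> minus a partial sum; this difference agrees with \<open>x\<close> far out
  and has small norm.
\<close>

lemma dominated_series:
  obtains C where "C > 0"
    "\<And>x (G :: nat \<Rightarrow> int set) f B. \<lbrakk>x \<in> X; \<And>M. finite (G M); mono G; B > 0;
       \<And>M k. k \<in> G M \<Longrightarrow> norm (f k) \<le> B * norm (x k)\<rbrakk> \<Longrightarrow>
     \<exists>s. tends_to (\<lambda>M. \<Sum>k\<in>G M. seq_scale (f k) (unit_seq k)) s sequentially \<and> N s \<le> C * B * N x"
proof -
  obtain C0 where C0: "C0 > 0" "\<And>x F. x \<in> X \<Longrightarrow> finite F \<Longrightarrow> N (proj F x) \<le> C0 * N x"
    using proj_uniformly_bounded by blast
  define C where "C = 2 * real DIM('a) * C0"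
  have C: "C > 0" using C0(1) by (simp add: C_def)
  let ?S = "\<lambda>f F. \<Sum>k\<in>F. seq_scale (f k) (unit_seq k)"
  have finite_bound: "N (?S f F) \<le> C * B * N x"
    if "x \<in> X" "finite F" "B > 0" "\<And>k. k \<in> F \<Longrightarrow> norm (f k) \<le> B * norm (x k)" for x F f B
  proof -
    have "?S f F = ?S (\<lambda>k. f k / x k * x k) F"
      using that(4) by (intro sum.cong) force+
    then have "N (?S f F) = N (?S (\<lambda>k. f k / x k * x k) F)" by (rule arg_cong)
    also have "\<dots> \<le> 2 * real DIM('a) * C0 * B * N x"
    proof (rule multiplier_bound[OF C0(2) that(1-3)])
      show "norm (f k / x k) \<le> B" if "k \<in> F" for k
        using that \<open>B > 0\<close> \<open>\<And>k. k \<in> F \<Longrightarrow> norm (f k) \<le> B * norm (x k)\<close>[OF that]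
        by (cases "x k = 0") (auto simp: norm_divide divide_le_eq)
    qed
    finally show ?thesis by (simp add: C_def)
  qed
  have "\<exists>s. tends_to (\<lambda>M. ?S f (G M)) s sequentially \<and> N s \<le> C * B * N x"
    if x: "x \<in> X" and fin: "\<And>M. finite (G M)" and G: "mono G" and B: "B > 0"
      and dom: "\<And>M k. k \<in> G M \<Longrightarrow> norm (f k) \<le> B * norm (x k)"
    for x f B and G :: "nat \<Rightarrow> int set"
  proof -
    have "\<exists>s. tends_to (\<lambda>M. ?S f (G M)) s sequentially"
    proof (rule Cauchy_tends_to)
      show "?S f (G M) \<in> X" for M by (intro sum_mem scale_mem unit_seq_mem)
      fix e :: real assume e: "e > 0"
      then have "e / (C * B) > 0" using C B by simp
      then obtain R :: nat where R: "N (proj {- int R..int R} x - x) < e / (C * B)"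
        using basis_symmetric_sums[OF x] unfolding tends_to_iff eventually_sequentially proj_def by blast
      define x' where "x' = x - proj {- int R..int R} x"
      have x': "x' \<in> X" "N x' < e / (C * B)"
        using R x by (auto simp: x'_def diff_mem proj_mem norm_diff_commute)
      have x'_eq: "x' k = x k" if "k \<notin> {- int R..int R}" for k
        using that by (auto simp: x'_def proj_apply)
      define H where "H = (\<Union>M. G M) \<inter> {- int R..int R}"
      have "\<forall>\<^sub>F M in sequentially. k \<in> G M" if k: "k \<in> H" for k
      proof -
        obtain M where M: "k \<in> G M" using k unfolding H_def by blast
        have "k \<in> G m" if "m \<ge> M" for m using monoD[OF G that] M by blast
        then show ?thesis using eventually_ge_at_top[of M] by (rule eventually_mono[rotated])
      qed
      then have "\<forall>\<^sub>F M in sequentially. \<forall>k\<in>H. k \<in> G M"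
        by (intro eventually_ball_finite) (auto simp: H_def)
      then obtain M0 where M0: "\<And>M. M \<ge> M0 \<Longrightarrow> H \<subseteq> G M" unfolding eventually_sequentially by blast
      have "N (?S f (G m) - ?S f (G n)) < e" if "n \<ge> M0" "m \<ge> n" for m n
      proof -
        have "?S f (G m) - ?S f (G n) = ?S f (G m - G n)"
          using fin monoD[OF G that(2)] by (intro sum_diff[symmetric])
        moreover have "N (?S f (G m - G n)) \<le> C * B * N x'"
        proof (rule finite_bound[OF x'(1) _ B])
          fix k assume k: "k \<in> G m - G n"
          then have "k \<notin> {- int R..int R}" using M0[OF that(1)] unfolding H_def by blast
          then show "norm (f k) \<le> B * norm (x' k)" using dom[of k m] k x'_eq by simp
        qed (use fin in auto)
        moreover have "C * B * N x' < e" using x'(2) C B by (simp add: field_simps)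
        ultimately show ?thesis by simp
      qed
      then show "\<exists>M. \<forall>n\<ge>M. \<forall>m\<ge>n. N (?S f (G m) - ?S f (G n)) < e" by blast
    qed
    then obtain s where s: "tends_to (\<lambda>M. ?S f (G M)) s sequentially" by blast
    have "N (?S f (G M)) \<le> C * B * N x" for M using x fin B dom by (rule finite_bound)
    then show ?thesis using s tends_to_norm_le[OF s] by auto
  qed
  from that[OF C this] show ?thesis .
qed

end

section \<open>From hypercyclicity to separated return times\<close>

context weighted_shift
begin

text \<open>
  Coefficients with respect to \<open>u\<close>; the backward shift acts on them as the unweighted one.
\<close>

definition coord :: "(int \<Rightarrow> 'k) \<Rightarrow> int \<Rightarrow> 'k"
  where "coord x k = x k / shift_coeff w k"

lemma coord_diff: "coord (x - y) k = coord x k - coord y k"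
  by (simp add: coord_def diff_divide_distrib)

lemma coord_shift_pow: "coord ((T ^^ m) x) k = coord x (int m + k)"
proof (induction m arbitrary: k)
  case (Suc m)
  have "w (k + 1) * shift_coeff w (k + 1) = shift_coeff w k"
    using shift_coeff_pred[of w "k + 1", OF weights_nonzero] by simp
  then have "coord (T y) k = coord y (k + 1)" for y
    using weights_nonzero[of "k + 1"] unfolding coord_def backward_shift_def
    by (metis mult_divide_mult_cancel_left)
  with Suc.IH[of "k + 1"] show ?case by (simp add: add_ac)
qed simp

lemma coord_bound: "\<exists>K\<ge>0. \<forall>x\<in>X. norm (coord x k) \<le> K * N x"
proof -
  obtain K where K: "\<And>x. x \<in> X \<Longrightarrow> norm (x k) \<le> K * N x" using coordinate_bound[of k] by blast
  have "norm (coord x k) \<le> \<bar>K\<bar> / norm (shift_coeff w k) * N x" if x: "x \<in> X" for x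
  proof -
    have "norm (x k) \<le> \<bar>K\<bar> * N x"
      using K[OF x] mult_right_mono[OF abs_ge_self norm_ge_zero[OF x], of K] by linarith
    then show ?thesis by (simp add: coord_def norm_divide divide_right_mono)
  qed
  then show ?thesis by (intro exI[of _ "\<bar>K\<bar> / norm (shift_coeff w k)"]) auto
qed

definition plateau :: "nat \<Rightarrow> (int \<Rightarrow> 'k)"
  where "plateau p = (\<Sum>j = - int p..int p. seq_scale (of_nat p) (u j))"

lemma plateau_mem: "plateau p \<in> X"
  unfolding plateau_def by (intro sum_mem scale_mem u_mem)

lemma coord_plateau: "coord (plateau p) k = (if \<bar>k\<bar> \<le> int p then of_nat p else 0)"
proof -
  have "plateau p k = (\<Sum>j = - int p..int p. if j = k then of_nat p * shift_coeff w k else 0)"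
    unfolding plateau_def sum_seq_apply
    by (intro sum.cong) (auto simp: seq_scale_apply unit_seq_def)
  then show ?thesis
    using shift_coeff_nonzero[of w k, OF weights_nonzero]
    by (auto simp: coord_def sum.delta')
qed

text \<open>
  The sets \<open>A p\<close> are the times at which the orbit is close to \<open>plateau p\<close>. The height \<open>p\<close> serves three
  purposes: different heights keep return times for different \<open>p\<close> apart, the drop from \<open>p\<close> to \<open>0\<close> at
  the edge keeps return times for the same \<open>p\<close> apart, and growing heights make the quotient by \<open>p\<close>
  tend to \<open>0\<close>, which produces the factor \<open>\<epsilon> p\<close> in the smallness condition.
\<close>

lemma condition_C_if_hypercyclic:
  assumes unc: "unconditional_unit_basis X N"
    and hyp: "family_hypercyclic \<A> X N T"
  shows "\<exists>\<epsilon>. positive_null_sequence \<epsilon> \<and> condition_C \<A> X N w \<epsilon>"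
proof -
  interpret unconditional_sequence_space X N by unfold_locales (rule unc)
  obtain C where C: "C > 0"
    "\<And>x (G :: nat \<Rightarrow> int set) f B. \<lbrakk>x \<in> X; \<And>M. finite (G M); mono G; B > 0;
       \<And>M k. k \<in> G M \<Longrightarrow> norm (f k) \<le> B * norm (x k)\<rbrakk> \<Longrightarrow>
     \<exists>s. tends_to (\<lambda>M. \<Sum>k\<in>G M. seq_scale (f k) (unit_seq k)) s sequentially \<and> N s \<le> C * B * N x"
    using dominated_series by blast
  have series_bound: "\<exists>s. series (\<lambda>n. u (int n + c)) V s \<and> N s \<le> C * (2 / real p) * N x"
    if x: "x \<in> X" and p: "p \<ge> 1" and large: "\<And>n. n \<in> V \<Longrightarrow> norm (coord x (int n + c)) \<ge> real p / 2"
    for x p V c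
  proof -
    define G where "G M = (\<lambda>n. int n + c) ` (V \<inter> {..<M})" for M
    have "\<exists>s. tends_to (\<lambda>M. \<Sum>k\<in>G M. u k) s sequentially \<and> N s \<le> C * (2 / real p) * N x"
    proof (rule C(2)[OF x])
      show "norm (shift_coeff w k) \<le> 2 / real p * norm (x k)" if k: "k \<in> G M" for M k
      proof -
        have v: "norm (shift_coeff w k) > 0"
          using shift_coeff_nonzero[of w k, OF weights_nonzero] by simp
        have "real p / 2 \<le> norm (coord x k)" using k large unfolding G_def by auto
        then have "real p / 2 * norm (shift_coeff w k) \<le> norm (x k)"
          using v by (simp add: coord_def norm_divide pos_le_divide_eq)
        then show ?thesis using p by (simp add: field_simps)
      qed
    qed (use p in \<open>auto simp: G_def intro!: monoI\<close>)
    moreover have "(\<Sum>k\<in>G M. u k) = (\<Sum>n\<in>V \<inter> {..<M}. u (int n + c))" for M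
      unfolding G_def by (subst sum.reindex) (auto simp: inj_on_def)
    ultimately show ?thesis unfolding has_series_sum_def by simp
  qed
  obtain x where x: "x \<in> X"
    "\<And>U. openin (norm_topology X N) U \<Longrightarrow> U \<noteq> {} \<Longrightarrow> {n. (T ^^ n) x \<in> U} \<in> \<A>"
    using hyp unfolding family_hypercyclic_def by blast
  define D where "D k = (SOME K. K \<ge> 0 \<and> (\<forall>x\<in>X. norm (coord x k) \<le> K * N x))" for k
  have D: "D k \<ge> 0" "y \<in> X \<Longrightarrow> norm (coord y k) \<le> D k * N y" for k y
    using someI_ex[OF coord_bound[of k]] unfolding D_def by blast+
  \<comment> \<open>The radius controls all coefficients in \<open>[-3p, 3p]\<close>, the range in which two overlapping
    plateaus of half-width \<open>p\<close> can meet, up to an error of \<open>1/4\<close>.\<close>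
  define \<eta> where "\<eta> p = 1 / (4 * real p * (1 + (\<Sum>k = - 3 * int p..3 * int p. D k)))" for p
  have D_sum: "(\<Sum>k = - 3 * int p..3 * int p. D k) \<ge> 0" for p using D(1) by (intro sum_nonneg) auto
  have \<eta>: "\<eta> p > 0" "\<eta> p \<le> 1 / real p" "\<And>k. \<bar>k\<bar> \<le> 3 * int p \<Longrightarrow> D k * \<eta> p \<le> 1 / 4" if p: "p \<ge> 1" for p
  proof -
    have s: "1 + (\<Sum>k = - 3 * int p..3 * int p. D k) \<ge> 1" using D_sum[of p] by simp
    show "\<eta> p > 0" using s p by (simp add: \<eta>_def)
    have "real p * 1 \<le> 4 * real p * (1 + (\<Sum>k = - 3 * int p..3 * int p. D k))"
      using s p by (intro mult_mono) auto
    then show "\<eta> p \<le> 1 / real p" using p unfolding \<eta>_def by (intro frac_le) auto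
    fix k assume "\<bar>k\<bar> \<le> 3 * int p"
    then have "D k \<le> (\<Sum>k = - 3 * int p..3 * int p. D k)" using D(1) by (intro member_le_sum) auto
    then have "1 * D k \<le> real p * (1 + (\<Sum>k = - 3 * int p..3 * int p. D k))"
      using p D(1)[of k] s by (intro mult_mono) auto
    moreover have "0 < real p * (1 + (\<Sum>k = - 3 * int p..3 * int p. D k))" using s p by simp
    ultimately show "D k * \<eta> p \<le> 1 / 4" unfolding \<eta>_def by (simp add: divide_le_eq)
  qed
  define A where "A p = {n. (T ^^ n) x \<in> {z \<in> X. N (z - plateau p) < \<eta> p}}" for p
  have A_mem: "A p \<in> \<A>" if p: "p \<ge> 1" for p
    unfolding A_def
  proof (rule x(2))
    show "openin (norm_topology X N) {z \<in> X. N (z - plateau p) < \<eta> p}"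
      by (rule openin_ball[OF plateau_mem])
    show "{z \<in> X. N (z - plateau p) < \<eta> p} \<noteq> {}"
      using plateau_mem[of p] \<eta>(1)[OF p] norm_zero by auto
  qed
  have near: "norm (coord x (int n + k) - (if \<bar>k\<bar> \<le> int p then of_nat p else 0)) \<le> 1 / 4"
    if n: "n \<in> A p" and p: "p \<ge> 1" and k: "\<bar>k\<bar> \<le> 3 * int p" for n p k
  proof -
    have z: "(T ^^ n) x - plateau p \<in> X" "N ((T ^^ n) x - plateau p) < \<eta> p"
      using n plateau_mem by (auto simp: A_def diff_mem)
    have "norm (coord ((T ^^ n) x - plateau p) k) \<le> D k * \<eta> p"
      using D(2)[OF z(1), of k] mult_left_mono[OF less_imp_le[OF z(2)] D(1)[of k]] by linarith
    then show ?thesis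
      using \<eta>(3)[OF p k] by (simp only: coord_diff coord_shift_pow coord_plateau)
  qed
  have large: "norm (coord x (int n + j)) \<ge> real p / 2"
    if "n \<in> A p" "p \<ge> 1" "\<bar>j\<bar> \<le> int p" for n p j
  proof -
    have "norm (coord x (int n + j) - of_nat p) \<le> 1 / 4" using near[of n p j] that by simp
    then have "real p - norm (coord x (int n + j)) \<le> 1 / 4"
      using norm_triangle_ineq2[of "of_nat p :: 'k" "coord x (int n + j)"]
      by (simp add: norm_minus_commute)
    then show ?thesis using that(2) by linarith
  qed
  have ordered_gap: "int m - int n > 2 * int p"
    if "n \<in> A p" "m \<in> A p" "p \<ge> 1" "n < m" for n m p
  proof (rule ccontr)
    assume "\<not> ?thesis"
    \<comment> \<open>The right edge of the plateau at \<open>m\<close> would lie just outside the plateau at \<open>n\<close>.\<close>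
    then have k: "\<bar>int m - int n + int p\<bar> \<le> 3 * int p" "\<not> \<bar>int m - int n + int p\<bar> \<le> int p"
      using that(4) by auto
    have "norm (coord x (int m + int p)) \<le> 1 / 4"
      using near[OF that(1,3) k(1)] k(2) by (simp add: algebra_simps)
    then show False using large[OF that(2,3), of "int p"] that(3) by simp
  qed
  have gap: "\<bar>int n - int m\<bar> > int p + int q"
    if n: "n \<in> A p" and m: "m \<in> A q" and pq: "p \<ge> 1" "q \<ge> 1" and ne: "n \<noteq> m \<or> p \<noteq> q" for n m p q
  proof (cases "p = q")
    case True
    then have "n \<noteq> m" using ne by simp
    then show ?thesis
      using ordered_gap[of n p m] ordered_gap[of m p n] n m pq True by (cases "n < m") auto
  next
    case False
    show ?thesis
    proof (rule ccontr)
      assume close: "\<not> ?thesis"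
      define d where "d = int m - int n"
      \<comment> \<open>A position in both plateaus: the point of \<open>[-p, p]\<close> nearest to \<open>d\<close>.\<close>
      define j where "j = (if d > int p then int p else if d < - int p then - int p else d)"
      have j: "\<bar>j\<bar> \<le> int p" "\<bar>j - d\<bar> \<le> int q"
        using close by (auto simp: j_def d_def)
      have "norm (coord x (int n + j) - of_nat p) \<le> 1 / 4"
        using near[OF n pq(1), of j] j by simp
      moreover have "norm (coord x (int n + j) - of_nat q) \<le> 1 / 4"
        using near[OF m pq(2), of "j - d"] j by (simp add: d_def add.commute)
      ultimately have "norm (of_nat q - of_nat p :: 'k) \<le> 1 / 2"
        using norm_triangle_ineq4[of "coord x (int n + j) - of_nat p" "coord x (int n + j) - of_nat q"]
        by simp
      moreover have "(of_nat q - of_nat p :: 'k) = of_int (int q - int p)" by simp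
      then have "norm (of_nat q - of_nat p :: 'k) = real_of_int \<bar>int q - int p\<bar>"
        by (simp only: norm_of_int)
      moreover have "\<bar>int q - int p\<bar> \<ge> 1" using False by auto
      ultimately show False by linarith
    qed
  qed
  have "disjoint_members \<A> A"
    unfolding disjoint_members_def disjoint_family_on_def
  proof (intro conjI allI impI ballI)
    fix p q :: nat assume "p \<in> {1..}" "q \<in> {1..}" "p \<noteq> q"
    then show "A p \<inter> A q = {}" using gap[of _ p _ q] by fastforce
  qed (rule A_mem)
  moreover have "shifted_series_converge X N w A"
    unfolding shifted_series_converge_def
  proof (intro allI impI)
    fix p :: nat assume p: "p \<ge> 1"
    have "norm (coord x (int n + int p)) \<ge> real p / 2" if "n \<in> A p" for n
      using large[OF that p, of "int p"] by simp
    from series_bound[OF x(1) p this]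
    show "\<exists>s. series (\<lambda>n. u (int n + int p)) (A p) s" by blast
  qed
  moreover have "small_differences X N w (\<lambda>p. {- int p..int p}) (\<lambda>p. 4 * C / real (Suc p)) A"
    unfolding small_differences_def
  proof (intro allI impI ballI)
    fix p q m j assume p: "p \<ge> 1" and q: "q \<ge> 1" and m: "m \<in> A q" and j: "j \<in> {- int p..int p}"
    \<comment> \<open>By the gap, the indices of the series avoid the plateau around \<open>m\<close>; there \<open>y\<close> agrees with
      \<open>(T ^^ m) x\<close>, so it has large coefficients at these indices although its norm is small.\<close>
    define y where "y = (T ^^ m) x - plateau q"
    have y: "y \<in> X" "N y < \<eta> q" using m plateau_mem by (auto simp: A_def y_def diff_mem)
    have "norm (coord y (int n + (j - int m))) \<ge> real p / 2" if n: "n \<in> A p - {m}" for n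
    proof -
      have "\<bar>int n - int m\<bar> > int p + int q" using gap[of n p m q] n m p q by auto
      then have "\<not> \<bar>int n + (j - int m)\<bar> \<le> int q" using j by auto
      then have "coord y (int n + (j - int m)) = coord x (int n + j)"
        by (simp add: y_def coord_diff coord_shift_pow coord_plateau)
      then show ?thesis using large[of n p j] n p j by auto
    qed
    from series_bound[OF y(1) p this]
    obtain s where s: "series (\<lambda>n. u (int n + (j - int m))) (A p - {m}) s"
      "N s \<le> C * (2 / real p) * N y" by blast
    have "N s < C * (2 / real p) * (1 / real q)"
    proof (rule le_less_trans[OF s(2)])
      have "N y < 1 / real q" using y(2) \<eta>(2)[OF q] by linarith
      then show "C * (2 / real p) * N y < C * (2 / real p) * (1 / real q)"
        using C(1) p by (intro mult_strict_left_mono) auto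
    qed
    moreover have "C * (2 / real p) * (1 / real q) \<le> min (4 * C / real (Suc p)) (4 * C / real (Suc q))"
    proof -
      have "C * (2 / real p) * (1 / real q) \<le> 4 * C / real (Suc r)" if "r \<le> p * q" for r
      proof -
        have "1 \<le> p * q" using p q by simp
        then have "real (Suc r) \<le> 2 * real (p * q)" using that by linarith
        then have "C * real (Suc r) \<le> C * (2 * real (p * q))" using C(1) by (intro mult_left_mono) auto
        then show ?thesis using p q by (simp add: field_simps)
      qed
      from this[of p] this[of q] show ?thesis using p q by simp
    qed
    ultimately have "N s < min (4 * C / real (Suc p)) (4 * C / real (Suc q))" by (rule less_le_trans)
    then show "\<exists>s. series (\<lambda>n. u (int n - int m + j)) (A p - {m}) s \<and>
        N s < min (4 * C / real (Suc p)) (4 * C / real (Suc q))"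
      using s(1) by (intro exI[of _ s]) (simp add: algebra_simps)
  qed
  moreover have "positive_null_sequence (\<lambda>p. 4 * C / real (Suc p))"
    using C(1) by (intro inverse_positive_null_sequence) simp
  ultimately show ?thesis unfolding condition_C_def by blast
qed

end

section \<open>Hypercyclicity of weighted shifts\<close>

theorem theorem15:
  fixes X :: "(int \<Rightarrow> 'k::{real_normed_field, euclidean_space}) set"
    and N :: "(int \<Rightarrow> 'k) \<Rightarrow> real"
    and w :: "int \<Rightarrow> 'k"
    and \<A> :: "nat set set"
  assumes "banach_sequence_space X N"
    and "unit_basis X N"
    and "\<And>n. w n \<noteq> 0"
    and "operator_on X N (backward_shift w)"
    and "furstenberg_family \<A>"
  shows
    "((\<exists>\<epsilon>. positive_null_sequence \<epsilon> \<and> condition_C \<A> X N w \<epsilon>) \<longleftrightarrow>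
        (\<forall>\<epsilon>. positive_null_sequence \<epsilon> \<longrightarrow> condition_C \<A> X N w \<epsilon>)) \<and>
     ((\<exists>\<epsilon>. positive_null_sequence \<epsilon> \<and> condition_C \<A> X N w \<epsilon>) \<longrightarrow>
        family_hypercyclic \<A> X N (backward_shift w)) \<and>
     (unconditional_unit_basis X N \<longrightarrow>
        family_hypercyclic \<A> X N (backward_shift w) \<longrightarrow>
        (\<exists>\<epsilon>. positive_null_sequence \<epsilon> \<and> condition_C \<A> X N w \<epsilon>)) \<and>
     (invertible_on X N (backward_shift w) \<longrightarrow>
        ((\<exists>\<epsilon>. positive_null_sequence \<epsilon> \<and> condition_C \<A> X N w \<epsilon>) \<longleftrightarrow>
          (\<exists>\<epsilon> A. positive_null_sequence \<epsilon> \<and> disjoint_members \<A> A \<and>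
             shifted_series_converge X N w A \<and>
             small_differences X N w (\<lambda>p. {0}) \<epsilon> A)) \<and>
        ((\<exists>\<epsilon>. positive_null_sequence \<epsilon> \<and> condition_C \<A> X N w \<epsilon>) \<longleftrightarrow>
          (\<exists>\<epsilon> A. positive_null_sequence \<epsilon> \<and> disjoint_members \<A> A \<and>
             unshifted_series_converge X N w A \<and>
             small_differences X N w (\<lambda>p. {- int p..int p}) \<epsilon> A)) \<and>
        ((\<exists>\<epsilon>. positive_null_sequence \<epsilon> \<and> condition_C \<A> X N w \<epsilon>) \<longleftrightarrow>
          (\<exists>\<epsilon> A. positive_null_sequence \<epsilon> \<and> disjoint_members \<A> A \<and>
             unshifted_series_converge X N w A \<and>
             small_differences X N w (\<lambda>p. {0}) \<epsilon> A)))"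
proof -
  interpret weighted_shift X N w
    using assms by (simp add: weighted_shift_def sequence_space_with_basis_def
        sequence_space_with_basis_axioms_def weighted_shift_axioms_def)
  let ?C = "\<exists>\<epsilon>. positive_null_sequence \<epsilon> \<and> condition_C \<A> X N w \<epsilon>"
  have null: "positive_null_sequence (\<lambda>k. 1 / real (Suc k))"
    by (rule inverse_positive_null_sequence) simp
  have "?C \<longleftrightarrow> (\<forall>\<epsilon>. positive_null_sequence \<epsilon> \<longrightarrow> condition_C \<A> X N w \<epsilon>)"
    using null condition_C_change_sequence by blast
  moreover have "?C \<longrightarrow> family_hypercyclic \<A> X N (backward_shift w)"
    using family_hypercyclic_if_condition_C[OF assms(5)] by blast
  moreover have "unconditional_unit_basis X N \<longrightarrow> family_hypercyclic \<A> X N (backward_shift w) \<longrightarrow> ?C"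
    using condition_C_if_hypercyclic by blast
  moreover have
    "(?C \<longleftrightarrow> (\<exists>\<epsilon> A. positive_null_sequence \<epsilon> \<and> disjoint_members \<A> A \<and>
        shifted_series_converge X N w A \<and> small_differences X N w (\<lambda>p. {0}) \<epsilon> A)) \<and>
     (?C \<longleftrightarrow> (\<exists>\<epsilon> A. positive_null_sequence \<epsilon> \<and> disjoint_members \<A> A \<and>
        unshifted_series_converge X N w A \<and> small_differences X N w (\<lambda>p. {- int p..int p}) \<epsilon> A)) \<and>
     (?C \<longleftrightarrow> (\<exists>\<epsilon> A. positive_null_sequence \<epsilon> \<and> disjoint_members \<A> A \<and>
        unshifted_series_converge X N w A \<and> small_differences X N w (\<lambda>p. {0}) \<epsilon> A))"
    if inv: "invertible_on X N (backward_shift w)"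
  proof -
    obtain S where "operator_on X N S" "\<forall>x\<in>X. S (T x) = x"
      using inv unfolding invertible_on_def by blast
    then interpret invertible_weighted_shift X N w S
      by unfold_locales auto
    have "small_differences X N w (\<lambda>p. {0}) \<epsilon> A"
      if "small_differences X N w (\<lambda>p. {- int p..int p}) \<epsilon> A" for \<epsilon> A
      unfolding small_differences_def
    proof (intro allI impI ballI)
      fix p q m :: nat and j :: int
      assume "p \<ge> 1" "q \<ge> 1" "m \<in> A q" "j \<in> {0 :: int}"
      moreover from this have "j \<in> {- int p..int p}" by simp
      ultimately show "\<exists>s. series (\<lambda>n. u (int n - int m + j)) (A p - {m}) s \<and>
          N s < min (\<epsilon> p) (\<epsilon> q)"
        using that unfolding small_differences_def by blast
    qed
    moreover have "?C"
      if "positive_null_sequence \<epsilon>" "disjoint_members \<A> A" "shifted_series_converge X N w A"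
        "small_differences X N w (\<lambda>p. {0}) \<epsilon> A" for \<epsilon> A
      using condition_C_from_central_differences[OF that] null by blast
    ultimately show ?thesis
      unfolding condition_C_def shifted_iff_unshifted[symmetric] by meson
  qed
  ultimately show ?thesis by blast
qed

end
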